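(* Let $\mathbf{M}$ be a Markov process with state space $(S,\mathcal{S})$ and transition function $p^{t}(x,dy)$, $t\in\mathbb{T}$, $x\in S$. Assume that there is $\pi\in\mathcal{P}(S)$ satisfying $$\lim_{t\to\infty}\ \sup_{s\in\mathbb{T}}\int_S d_W\big(p^{t}(y,dz),\pi(dz)\big)\,p^{s}(x,dy)=0\qquad\text{for every } x\in S.$$ Then, for every $p\ge1$, every $f\in Lip(S)$ and every $\mu\in\mathcal{P}(S)$, $$\frac{1}{t}\int_{[0,t)}f(M_s)\,\tau(ds)\longrightarrow \int_S f(y)\,\pi(dy)\qquad\text{in } L^p(\Omega,\mathbb{P}^{\mu})\ \text{ as } t\nearrow\infty,\ t\in\mathbb{T}.$$
   Context: State space: $(S,d)$ is a non-empty Polish space, i.e. $d$ is a complete and separable metric on $S$, $\mathcal{S}$ is its Borel $\sigma$-algebra, and $d$ is bounded by $1$: $\sup_{x,y\in S}d(x,y)\le 1$. The time set $\mathbb{T}$ is either $\{0,1,2,\ldots\}$ or $[0,\infty)$, and $\tau$ is the counting measure on $\mathbb{T}$ in the first case and Lebesgue measure in the second. Process: $\mathbf{M}=(\Omega,\mathcal{F},\{\mathbb{P}^{x}\}_{x\in S},\{\mathcal{F}_t\}_{t\in\mathbb{T}},\{\theta_t\}_{t\in\mathbb{T}},\{M_t\}_{t\in\mathbb{T}})$ is a temporally homogeneous normal Markov process with state space $(S,\mathcal{S})$: each $(\Omega,\mathcal{F},\mathbb{P}^x)$ is a probability space; $\{\mathcal{F}_t\}$ is a filtration; $M_t:\Omega\to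 S$ is $\mathcal{F}_t/\mathcal{S}$-measurable; $\mathbb{P}^x(M_0=x)=1$ (normality); $x\mapsto\mathbb{P}^x(B)$ is $\mathcal{S}$-measurable for $B\in\mathcal{F}$; the shift operators $\theta_t:\Omega\to\Omega$ satisfy $M_t\circ\theta_s=M_{t+s}$; and the Markov property $\mathbb{P}^x(M_{t+s}\in B\mid\mathcal{F}_t)=p^s(M_t,B)$ $\mathbb{P}^x$-a.s. holds for all $s,t\in\mathbb{T}$, $x\in S$, $B\in\mathcal{S}$, where $p^{t}(x,dy):=\mathbb{P}^{x}(M_t\in dy)$ is the transition function. If $\mathbb{T}=[0,\infty)$, $\mathbf{M}$ is assumed progressively measurable: for each $t\ge0$ the map $(s,\omega)\mapsto M_s(\omega)$ from $[0,t]\times\Omega$ to $S$ is $\mathcal{B}([0,t])\times\mathcal{F}_t/\mathcal{S}$-measurable. $\mathcal{P}(S)$ is the set of probability measures on $\mathcal{S}$; for $\mu\in\mathcal{P}(S)$, $\mathbb{P}^\mu(d\omega):=\int_S\mathbb{P}^y(d\omega)\,\mu(dy)$. $Lip(S)$ is the space of all $f:S\to\mathbb{R}$ for which there is $L_f\ge0$ with $|f(x)-f(y)|\le L_f\,d(x,y)$ for all $x,y\in S$; the best constant is denoted $|f|_{Lip}$. Since $d\le1$, every $f\in Lip(S)$ is bounded. The $L^1$-Wasserstein metric on $\mathcal{P}(S)$ is $$d_W(\mu,\nu):=\sup_{f\in Lip(S),\,|f|_{Lip}\le1}\left|\int_S f\,d\mu-\int_S f\,d\nu\right|.$$ The function $x\mapsto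 d_W(p^t(x,dy),\pi(dy))$ is $\mathcal{S}$-measurable for each $t\in\mathbb{T}$. *)

theory Defs
  imports "HOL-Probability.Probability"
begin

text \<open>
  The state space is a type of class \<^class>\<open>polish_space\<close>, with metric \<^const>\<open>dist\<close> and
  \<open>\<sigma>\<close>-algebra \<^term>\<open>borel\<close>. Probability measures on it are the elements of
  \<^term>\<open>space (prob_algebra borel)\<close>.
\<close>

section \<open>Lipschitz functions and the Wasserstein metric\<close>

definition Lip :: "('s::metric_space \<Rightarrow> real) set" where
  "Lip = {f. \<exists>L. L-lipschitz_on UNIV f}"

definition lip_const :: "('s::metric_space \<Rightarrow> real) \<Rightarrow> real" where
  "lip_const f = Inf {L. L-lipschitz_on UNIV f}"

text \<open>
  The supremum is one of reals. It is over a nonempty set, and over a bounded one when \<open>dist \<le> 1\<close>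
  and \<open>\<mu>\<close>, \<open>\<nu>\<close> are probability measures on \<^term>\<open>borel\<close>, the only case in which it is used.
\<close>

definition wasserstein :: "'s::metric_space measure \<Rightarrow> 's measure \<Rightarrow> real" where
  "wasserstein \<mu> \<nu> = (SUP f \<in> {f \<in> Lip. lip_const f \<le> 1}. \<bar>(\<integral>y. f y \<partial>\<mu>) - (\<integral>y. f y \<partial>\<nu>)\<bar>)"


section \<open>Markov processes\<close>

text \<open>
  Both time sets are embedded in \<^typ>\<open>real\<close>; objects indexed by time are functions on
  \<^typ>\<open>real\<close> of which only the values on \<open>T\<close> are constrained or used.
\<close>

definition time_set :: "real set \<Rightarrow> real measure \<Rightarrow> bool" where
  "time_set T \<tau> \<longleftrightarrow>
     (T = \<nat> \<and> \<tau> = count_space \<nat>) \<or> (T = {0..} \<and> \<tau> = restrict_space lborel {0..})"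

definition transition :: "('s \<Rightarrow> 'w measure) \<Rightarrow> (real \<Rightarrow> 'w \<Rightarrow> 's::topological_space) \<Rightarrow>
    real \<Rightarrow> 's \<Rightarrow> 's measure" where
  "transition P M t x = distr (P x) borel (M t)"

text \<open>
  Of the measures \<open>A\<close> and \<open>F t\<close> only the space and the \<open>\<sigma>\<close>-algebra matter: they represent
  \<open>(\<Omega>, \<F>)\<close> and \<open>(\<Omega>, \<F>\<^sub>t)\<close>. Assumption \<open>kernel\<close> says that every \<open>P x\<close> is a
  probability measure on \<open>A\<close> and that \<open>x \<mapsto> P x B\<close> is measurable for every \<open>B \<in> sets A\<close>.
\<close>

locale markov_process =
  fixes T :: "real set" and \<tau> :: "real measure"
    and A :: "'w measure"
    and P :: "'s::polish_space \<Rightarrow> 'w measure"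
    and F :: "real \<Rightarrow> 'w measure"
    and \<theta> :: "real \<Rightarrow> 'w \<Rightarrow> 'w"
    and M :: "real \<Rightarrow> 'w \<Rightarrow> 's"
  assumes time: "time_set T \<tau>"
    and kernel: "P \<in> borel \<rightarrow>\<^sub>M prob_algebra A"
    and filtration_subalgebra: "\<And>t. t \<in> T \<Longrightarrow> subalgebra A (F t)"
    and filtration_mono: "\<And>s t. s \<in> T \<Longrightarrow> t \<in> T \<Longrightarrow> s \<le> t \<Longrightarrow> sets (F s) \<subseteq> sets (F t)"
    and adapted: "\<And>t. t \<in> T \<Longrightarrow> M t \<in> F t \<rightarrow>\<^sub>M borel"
    and normal: "\<And>x. measure (P x) {\<omega> \<in> space A. M 0 \<omega> = x} = 1"
    and shift_closed: "\<And>t. t \<in> T \<Longrightarrow> \<theta> t \<in> space A \<rightarrow> space A"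
    and shift: "\<And>s t \<omega>. s \<in> T \<Longrightarrow> t \<in> T \<Longrightarrow> \<omega> \<in> space A \<Longrightarrow> M t (\<theta> s \<omega>) = M (t + s) \<omega>"
    and markov: "\<And>s t x B. s \<in> T \<Longrightarrow> t \<in> T \<Longrightarrow> B \<in> sets borel \<Longrightarrow>
      AE \<omega> in P x. real_cond_exp (P x) (F t) (indicator {\<omega> \<in> space A. M (t + s) \<omega> \<in> B}) \<omega>
        = measure (transition P M s (M t \<omega>)) B"
    and progressive: "\<And>t. T = {0..} \<Longrightarrow> 0 \<le> t \<Longrightarrow>
      (\<lambda>(s, \<omega>). M s \<omega>) \<in> restrict_space borel {0..t} \<Otimes>\<^sub>M F t \<rightarrow>\<^sub>M borel"


section \<open>Convergence in \<open>L\<^sup>p\<close>\<close>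

definition Lp_space :: "real \<Rightarrow> 'w measure \<Rightarrow> ('w \<Rightarrow> real) set" where
  "Lp_space p N = {X \<in> borel_measurable N. integrable N (\<lambda>\<omega>. \<bar>X \<omega>\<bar> powr p)}"

definition Lp_norm :: "real \<Rightarrow> 'w measure \<Rightarrow> ('w \<Rightarrow> real) \<Rightarrow> real" where
  "Lp_norm p N X = (\<integral>\<omega>. \<bar>X \<omega>\<bar> powr p \<partial>N) powr (1 / p)"

definition converges_in_Lp :: "real \<Rightarrow> 'w measure \<Rightarrow> real set \<Rightarrow> (real \<Rightarrow> 'w \<Rightarrow> real) \<Rightarrow>
    ('w \<Rightarrow> real) \<Rightarrow> bool" where
  "converges_in_Lp p N I X Y \<longleftrightarrow>
     (\<forall>t\<in>I. X t \<in> Lp_space p N) \<and> Y \<in> Lp_space p N \<and>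
     ((\<lambda>t. Lp_norm p N (\<lambda>\<omega>. X t \<omega> - Y \<omega>)) \<longlongrightarrow> 0) (inf at_top (principal I))"

end

theory Submission
  imports Defs
begin

text \<open>
  Centre \<open>f\<close> by its \<open>\<pi>\<close>-mean and call the result \<open>h\<close>. By the Markov property
  \<open>E\<^sup>x[h(M\<^sub>u) h(M\<^sub>s)]\<close>, for \<open>u \<le> s\<close>, is at most a constant times the integral of
  \<open>d\<^sub>W(p\<^sup>r(y), \<pi>)\<close> with respect to \<open>p\<^sup>u(x, dy)\<close>, where \<open>r = s - u\<close>; this is small
  uniformly in \<open>u\<close> once \<open>r\<close> is large. Pairs of times in \<open>[0, t)\<close> at bounded distance have
  measure \<open>O(t)\<close> out of \<open>t\<^sup>2\<close>, so the second moment of the centred time average vanishes as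
  \<open>t\<close> grows. Dominated convergence passes from \<open>P\<^sup>x\<close> to \<open>P\<^sup>\<mu>\<close>, and boundedness passes from
  \<open>L\<^sup>2\<close> to \<open>L\<^sup>p\<close>.
\<close>

section \<open>Lipschitz test functions and bounds for the Wasserstein distance\<close>

text \<open>Every difference quotient is a lower bound of the set of admissible constants, so it
  stays below their infimum. Membership in \<open>Lip\<close> keeps that set nonempty.\<close>

lemma lip_const_le_one_iff:
  fixes f :: "'s::metric_space \<Rightarrow> real"
  shows "f \<in> Lip \<and> lip_const f \<le> 1 \<longleftrightarrow> 1-lipschitz_on UNIV f"
proof
  assume f: "f \<in> Lip \<and> lip_const f \<le> 1"
  then have ne: "{L. L-lipschitz_on UNIV f} \<noteq> {}"
    by (auto simp: Lip_def)
  have "dist (f x) (f y) \<le> 1 * dist x y" for x y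
  proof (cases "x = y")
    case False
    have "dist (f x) (f y) / dist x y \<le> lip_const f"
      unfolding lip_const_def using ne False
      by (intro cInf_greatest) (auto simp: divide_le_eq lipschitz_on_def)
    also have "\<dots> \<le> 1" using f by simp
    finally show ?thesis using False by (simp add: divide_le_eq)
  qed simp
  then show "1-lipschitz_on UNIV f"
    by (simp add: lipschitz_on_def)
next
  assume f: "1-lipschitz_on UNIV f"
  then have "lip_const f \<le> 1"
    unfolding lip_const_def
    by (intro cInf_lower bdd_belowI[where m=0]) (auto simp: lipschitz_on_def)
  with f show "f \<in> Lip \<and> lip_const f \<le> 1" by (auto simp: Lip_def)
qed

lemma wasserstein_eq:
  "wasserstein \<mu> \<nu> = (SUP f \<in> {f. 1-lipschitz_on UNIV f}. \<bar>(\<integral>y. f y \<partial>\<mu>) - (\<integral>y. f y \<partial>\<nu>)\<bar>)"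
  unfolding wasserstein_def by (simp add: lip_const_le_one_iff cong: conj_cong)

lemma lipschitz_borel_measurable:
  fixes f :: "'s::metric_space \<Rightarrow> real"
  shows "L-lipschitz_on UNIV f \<Longrightarrow> f \<in> borel_measurable borel"
  by (intro borel_measurable_continuous_onI lipschitz_on_continuous_on)

lemma lipschitz_bounded:
  fixes f :: "'s::metric_space \<Rightarrow> real"
  assumes diam: "\<And>x y :: 's. dist x y \<le> 1" and f: "L-lipschitz_on UNIV f"
  shows "\<bar>f x - f y\<bar> \<le> L"
proof -
  have "\<bar>f x - f y\<bar> \<le> L * dist x y"
    using f by (simp add: lipschitz_on_def dist_real_def)
  also have "\<dots> \<le> L * 1"
    using lipschitz_on_nonneg[OF f] diam by (intro mult_left_mono)
  finally show ?thesis by simp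
qed

lemma integrable_lipschitz:
  fixes f :: "'s::metric_space \<Rightarrow> real"
  assumes diam: "\<And>x y :: 's. dist x y \<le> 1" and f: "L-lipschitz_on UNIV f"
    and \<mu>: "\<mu> \<in> space (prob_algebra borel)"
  shows "integrable \<mu> f"
proof -
  interpret prob_space \<mu> using \<mu> by (simp add: space_prob_algebra)
  have [measurable_cong]: "sets \<mu> = sets borel" using \<mu> by (simp add: space_prob_algebra)
  note lipschitz_borel_measurable[OF f, measurable]
  fix x
  have "\<bar>f y\<bar> \<le> \<bar>f x\<bar> + L" for y
    using lipschitz_bounded[OF diam f, of y x] by linarith
  then show ?thesis
    by (intro integrable_const_bound[where B="\<bar>f x\<bar> + L"]) auto
qed

text \<open>Diameter at most one bounds the oscillation of \<open>f\<close> by \<open>L\<close>,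
  hence its mean under any probability law lies within \<open>L\<close> of every value. This later
  bounds the centred function uniformly.\<close>

lemma lipschitz_minus_integral_bound:
  fixes f :: "'s::metric_space \<Rightarrow> real"
  assumes diam: "\<And>x y :: 's. dist x y \<le> 1" and f: "L-lipschitz_on UNIV f"
    and \<mu>: "\<mu> \<in> space (prob_algebra borel)"
  shows "\<bar>f x - (\<integral>y. f y \<partial>\<mu>)\<bar> \<le> L"
proof -
  interpret prob_space \<mu> using \<mu> by (simp add: space_prob_algebra)
  note [simp] = integrable_lipschitz[OF diam f \<mu>]
  have "f x - L \<le> (\<integral>y. f y \<partial>\<mu>)"
    using lipschitz_bounded[OF diam f] by (intro integral_ge_const) (auto simp: abs_le_iff algebra_simps)
  moreover have "(\<integral>y. f y \<partial>\<mu>) \<le> f x + L"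
    using lipschitz_bounded[OF diam f] by (intro integral_le_const) (auto simp: abs_le_iff algebra_simps)
  ultimately show ?thesis by linarith
qed

lemma lipschitz_integral_diff_bound:
  fixes f :: "'s::metric_space \<Rightarrow> real"
  assumes diam: "\<And>x y :: 's. dist x y \<le> 1" and f: "L-lipschitz_on UNIV f"
    and \<mu>: "\<mu> \<in> space (prob_algebra borel)" and \<nu>: "\<nu> \<in> space (prob_algebra borel)"
  shows "\<bar>(\<integral>y. f y \<partial>\<mu>) - (\<integral>y. f y \<partial>\<nu>)\<bar> \<le> 2 * L"
  \<comment> \<open>\<open>undefined\<close> is just some point of the space: both means lie within
    \<open>L\<close> of the value of \<open>f\<close> there.\<close>
  using lipschitz_minus_integral_bound[OF diam f \<mu>, of undefined]
    lipschitz_minus_integral_bound[OF diam f \<nu>, of undefined] by linarith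

text \<open>A real supremum dominates its members only over bounded sets. Any set \<open>I\<close>
  of test functions is allowed so that both the full class and a countable subclass are
  covered.\<close>

lemma bdd_above_wasserstein:
  fixes \<mu> \<nu> :: "'s::metric_space measure"
  assumes diam: "\<And>x y :: 's. dist x y \<le> 1"
    and \<mu>: "\<mu> \<in> space (prob_algebra borel)" and \<nu>: "\<nu> \<in> space (prob_algebra borel)"
    and I: "(I :: ('s \<Rightarrow> real) set) \<subseteq> {f. 1-lipschitz_on UNIV f}"
  shows "bdd_above ((\<lambda>f. \<bar>(\<integral>y. f y \<partial>\<mu>) - (\<integral>y. f y \<partial>\<nu>)\<bar>) ` I)"
proof (rule bdd_aboveI2[where M=2])
  fix f assume "f \<in> I"
  then show "\<bar>(\<integral>y. f y \<partial>\<mu>) - (\<integral>y. f y \<partial>\<nu>)\<bar> \<le> 2"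
    using lipschitz_integral_diff_bound[OF diam _ \<mu> \<nu>, of 1 f] I by auto
qed

lemma wasserstein_bounds:
  fixes \<mu> \<nu> :: "'s::metric_space measure"
  assumes diam: "\<And>x y :: 's. dist x y \<le> 1"
    and \<mu>: "\<mu> \<in> space (prob_algebra borel)" and \<nu>: "\<nu> \<in> space (prob_algebra borel)"
  shows "0 \<le> wasserstein \<mu> \<nu>" "wasserstein \<mu> \<nu> \<le> 2"
proof -
  have 0: "1-lipschitz_on UNIV (\<lambda>_::'s. 0::real)"
    by (simp add: lipschitz_on_def)
  then show "0 \<le> wasserstein \<mu> \<nu>"
    unfolding wasserstein_eq
    by (intro cSUP_upper2[OF bdd_above_wasserstein[OF diam \<mu> \<nu>]]) auto
  show "wasserstein \<mu> \<nu> \<le> 2"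
    unfolding wasserstein_eq
    using 0 lipschitz_integral_diff_bound[OF diam _ \<mu> \<nu>, of 1]
    by (intro cSUP_least) force+
qed

text \<open>Dividing \<open>f\<close> by \<open>L\<close> yields a test function of the supremum,
  and linearity of the integral restores the factor.\<close>

lemma integral_diff_le_wasserstein:
  fixes f :: "'s::metric_space \<Rightarrow> real"
  assumes diam: "\<And>x y :: 's. dist x y \<le> 1" and f: "L-lipschitz_on UNIV f" and "L > 0"
    and \<mu>: "\<mu> \<in> space (prob_algebra borel)" and \<nu>: "\<nu> \<in> space (prob_algebra borel)"
  shows "\<bar>(\<integral>y. f y \<partial>\<mu>) - (\<integral>y. f y \<partial>\<nu>)\<bar> \<le> L * wasserstein \<mu> \<nu>"
proof -
  have "1-lipschitz_on UNIV (\<lambda>x. f x / L)"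
    using f \<open>L > 0\<close> by (simp add: lipschitz_on_def dist_real_def field_simps
        flip: diff_divide_distrib)
  then have "\<bar>(\<integral>y. f y / L \<partial>\<mu>) - (\<integral>y. f y / L \<partial>\<nu>)\<bar> \<le> wasserstein \<mu> \<nu>"
    unfolding wasserstein_eq
    by (intro cSUP_upper bdd_above_wasserstein[OF diam \<mu> \<nu>]) auto
  also have "(\<integral>y. f y / L \<partial>\<mu>) - (\<integral>y. f y / L \<partial>\<nu>) = ((\<integral>y. f y \<partial>\<mu>) - (\<integral>y. f y \<partial>\<nu>)) / L"
    by (simp add: diff_divide_distrib)
  finally show ?thesis using \<open>L > 0\<close> by (simp add: field_simps)
qed

section \<open>McShane extensions and measurability of the Wasserstein distance\<close>

text \<open>A pair \<open>(d, q)\<close> prescribes the height \<open>q\<close> at the point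
  \<open>d\<close>. For finite nonempty data this is the McShane extension: the largest 1-Lipschitz
  function that is at most \<open>q\<close> at \<open>d\<close> for every pair.\<close>

definition mcshane :: "('s::metric_space \<times> real) set \<Rightarrow> 's \<Rightarrow> real" where
  "mcshane A x = Min ((\<lambda>(d, q). q + dist x d) ` A)"

lemma mcshane_le: "finite A \<Longrightarrow> (d, q) \<in> A \<Longrightarrow> mcshane A x \<le> q + dist x d"
  unfolding mcshane_def by (intro Min_le) force+

lemma mcshane_attained:
  assumes "finite A" "A \<noteq> {}"
  obtains d q where "(d, q) \<in> A" "mcshane A x = q + dist x d"
proof -
  have "mcshane A x \<in> (\<lambda>(d, q). q + dist x d) ` A"
    unfolding mcshane_def using assms by (intro Min_in) auto
  then show ?thesis using that by auto
qed

text \<open>The pair attaining the minimum at \<open>y\<close> competes for the minimum at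
  \<open>x\<close>, where its cone is higher by at most \<open>dist x y\<close>; exchanging
  \<open>x\<close> and \<open>y\<close> gives the other half.\<close>

lemma mcshane_lipschitz:
  assumes "finite A" "A \<noteq> {}"
  shows "1-lipschitz_on UNIV (mcshane A)"
proof -
  have *: "mcshane A x \<le> mcshane A y + dist x y" for x y
  proof -
    obtain d q where dq: "(d, q) \<in> A" "mcshane A y = q + dist y d"
      using mcshane_attained[OF assms] .
    have "mcshane A x \<le> q + dist x d"
      using mcshane_le assms dq by blast
    also have "\<dots> \<le> q + (dist x y + dist y d)"
      by (intro add_left_mono dist_triangle)
    finally show ?thesis using dq by simp
  qed
  show ?thesis
    using * by (auto simp: lipschitz_on_def dist_real_def abs_le_iff algebra_simps)
      (metis dist_commute)
qed

text \<open>The data of stage \<open>n\<close> are the first \<open>n + 1\<close> terms of an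
  enumeration of \<open>D\<close>, with rational heights just above \<open>f\<close>. All cones then
  lie above \<open>f\<close>, and near a data point the extension exceeds \<open>f\<close> only
  slightly, so density of \<open>D\<close> forces pointwise convergence. The uniform bound prepares
  dominated convergence.\<close>

lemma mcshane_dense:
  fixes f :: "'s::metric_space \<Rightarrow> real"
  assumes diam: "\<And>x y :: 's. dist x y \<le> 1" and f: "1-lipschitz_on UNIV f"
    and D: "countable D" "D \<noteq> {}" "\<And>x e. e > 0 \<Longrightarrow> \<exists>d\<in>D. dist x d < e"
  obtains A where "\<And>n::nat. finite (A n)" "\<And>n. A n \<noteq> {}" "\<And>n. A n \<subseteq> D \<times> \<rat>"
    "\<And>x. (\<lambda>n. mcshane (A n) x) \<longlonglongrightarrow> f x" "\<And>n x. \<bar>mcshane (A n) x - f x\<bar> \<le> 3"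
proof -
  define e where "e = from_nat_into D"
  have e: "range e = D" using D by (simp add: e_def range_from_nat_into)
  have "\<exists>q\<in>\<rat>. f d < q \<and> q < f d + 1 / real (Suc n)" for d n
    by (intro Rats_dense_in_real) simp
  then obtain q where q: "\<And>d n. q d n \<in> \<rat>" "\<And>d n. f d < q d n"
    "\<And>d n. q d n < f d + 1 / real (Suc n)"
    by metis
  define A where "A n = (\<lambda>i. (e i, q (e i) n)) ` {..n}" for n
  have A: "finite (A n)" "A n \<noteq> {}" "A n \<subseteq> D \<times> \<rat>" for n
    using q e by (auto simp: A_def)
  have fle: "f x \<le> f d + dist x d" "f d \<le> f x + dist x d" for x d
    using lipschitz_onD[OF f, of x d] by (auto simp: dist_real_def abs_le_iff)
  have lower: "f x \<le> mcshane (A n) x" for n x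
  proof -
    obtain d p where dp: "(d, p) \<in> A n" "mcshane (A n) x = p + dist x d"
      using mcshane_attained[OF A(1,2)] .
    have "f d < p" using dp(1) q by (auto simp: A_def)
    with fle(1)[of x d] dp show ?thesis by simp
  qed
  have upper: "mcshane (A n) x \<le> f x + 2 * dist x (e i) + 1 / real (Suc n)" if "i \<le> n" for n x i
  proof -
    have "mcshane (A n) x \<le> q (e i) n + dist x (e i)"
      using that A by (intro mcshane_le) (auto simp: A_def)
    with fle(2)[where x=x and d="e i"] q(3)[of "e i" n] show ?thesis by linarith
  qed
  show ?thesis
  proof (rule that[OF A])
    fix x
    show "(\<lambda>n. mcshane (A n) x) \<longlonglongrightarrow> f x"
    proof (rule LIMSEQ_I)
      fix r :: real assume r: "r > 0"
      \<comment> \<open>By \<open>upper\<close> the distance counts twice, so two quarters from it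
        and one from the slack stay below \<open>r\<close>. Taking \<open>n\<close> at least
        \<open>i\<close> puts \<open>e i\<close> among the data.\<close>
      obtain d where "d \<in> D" "dist x d < r / 4" using D(3)[of "r/4" x] r by auto
      then obtain i where i: "dist x (e i) < r / 4" using e by auto
      obtain N where N: "1 / real (Suc N) < r / 4"
        using r by (metis nat_approx_posE divide_pos_pos zero_less_numeral)
      have "norm (mcshane (A n) x - f x) < r" if n: "n \<ge> max i N" for n
      proof -
        have "1 / real (Suc n) \<le> 1 / real (Suc N)"
          using n by (intro divide_left_mono) auto
        with upper[of i n x] lower[of x n] n i N show ?thesis
          by auto
      qed
      then show "\<exists>no. \<forall>n\<ge>no. norm (mcshane (A n) x - f x) < r" by blast
    qed
    fix n
    \<comment> \<open>The point \<open>e 0\<close> belongs to every stage: twice the diameter plus a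
      slack of at most 1 gives 3.\<close>
    have "1 / real (Suc n) \<le> 1" by simp
    with upper[of 0 n x] lower[of x n] diam[of x "e 0"] show "\<bar>mcshane (A n) x - f x\<bar> \<le> 3"
      unfolding abs_le_iff by linarith
  qed
qed

text \<open>The supremum defining \<^const>\<open>wasserstein\<close> is over an uncountable set. Restricting it
  to the countably many McShane extensions of rational data on finite subsets of a dense sequence
  makes the distance a measurable function of the measure.\<close>

lemma wasserstein_countable:
  fixes \<nu> :: "'s::polish_space measure"
  assumes diam: "\<And>x y :: 's. dist x y \<le> 1"
  obtains G :: "('s \<Rightarrow> real) set" where "countable G" "G \<subseteq> {f. 1-lipschitz_on UNIV f}"
    "\<And>\<mu> \<nu>. \<mu> \<in> space (prob_algebra borel) \<Longrightarrow> \<nu> \<in> space (prob_algebra borel) \<Longrightarrow>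
      wasserstein \<mu> \<nu> = (SUP f\<in>G. \<bar>(\<integral>y. f y \<partial>\<mu>) - (\<integral>y. f y \<partial>\<nu>)\<bar>)"
proof -
  obtain D :: "'s set" where D: "countable D" "\<And>X. open X \<Longrightarrow> X \<noteq> {} \<Longrightarrow> \<exists>d\<in>D. d \<in> X"
    using countable_dense_setE by blast
  have D2: "\<exists>d\<in>D. dist x d < e" if "e > 0" for x e
    using D(2)[of "ball x e"] that by auto
  then have D3: "D \<noteq> {}" by (metis empty_iff zero_less_one)
  define G where "G = mcshane ` {A. finite A \<and> A \<noteq> {} \<and> A \<subseteq> D \<times> (\<rat>::real set)}"
  have "countable {A. finite A \<and> A \<subseteq> D \<times> (\<rat>::real set)}"
    using D(1) by (intro countable_Collect_finite_subset countable_SIGMA countable_rat)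
  then have c: "countable G"
    unfolding G_def by (intro countable_image) (auto elim: countable_subset[rotated])
  have G: "G \<subseteq> {f. 1-lipschitz_on UNIV f}"
    unfolding G_def by (auto intro: mcshane_lipschitz)
  have Gne: "G \<noteq> {}"
  proof -
    obtain d where "d \<in> D" using D3 by auto
    then have "mcshane {(d, 0)} \<in> G" unfolding G_def by (intro imageI) auto
    then show ?thesis by auto
  qed
  show ?thesis
  proof (rule that[OF c G])
    fix \<mu> \<nu> :: "'s measure"
    assume \<mu>: "\<mu> \<in> space (prob_algebra borel)" and \<nu>: "\<nu> \<in> space (prob_algebra borel)"
    let ?d = "\<lambda>f. \<bar>(\<integral>y. f y \<partial>\<mu>) - (\<integral>y. f y \<partial>\<nu>)\<bar>"
    \<comment> \<open>Each test function is a pointwise limit of members of \<open>G\<close>.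
      Dominated convergence under both laws carries the limit through \<open>?d\<close>, so the
      supremum over \<open>G\<close> already dominates the value at \<open>f\<close>.\<close>
    have "?d f \<le> (SUP f\<in>G. ?d f)" if f: "1-lipschitz_on UNIV f" for f
    proof -
      obtain A where A: "\<And>n::nat. finite (A n)" "\<And>n. A n \<noteq> {}" "\<And>n. A n \<subseteq> D \<times> \<rat>"
        "\<And>x. (\<lambda>n. mcshane (A n) x) \<longlonglongrightarrow> f x" "\<And>n x. \<bar>mcshane (A n) x - f x\<bar> \<le> 3"
        using mcshane_dense[OF diam f D(1) D3 D2] by blast
      have AG: "mcshane (A n) \<in> G" for n using A by (auto simp: G_def)
      have conv: "(\<lambda>n. \<integral>y. mcshane (A n) y \<partial>\<mu>) \<longlonglongrightarrow> (\<integral>y. f y \<partial>\<mu>)"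
        if \<mu>: "\<mu> \<in> space (prob_algebra borel)" for \<mu>
      proof -
        interpret prob_space \<mu> using \<mu> by (simp add: space_prob_algebra)
        have [measurable_cong]: "sets \<mu> = sets borel" using \<mu> by (simp add: space_prob_algebra)
        have [measurable]: "mcshane (A n) \<in> borel_measurable borel" for n
          using AG G lipschitz_borel_measurable by blast
        note lipschitz_borel_measurable[OF f, measurable]
        show ?thesis
        proof (rule integral_dominated_convergence[where w="\<lambda>x. \<bar>f x\<bar> + 3"])
          show "AE x in \<mu>. norm (mcshane (A n) x) \<le> \<bar>f x\<bar> + 3" for n
          proof (rule AE_I2)
            fix x show "norm (mcshane (A n) x) \<le> \<bar>f x\<bar> + 3" using A(5)[of n x] by simp
          qed
        qed (use A integrable_lipschitz[OF diam f \<mu>] in auto)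
      qed
      have "(\<lambda>n. ?d (mcshane (A n))) \<longlonglongrightarrow> ?d f"
        by (intro tendsto_intros conv \<mu> \<nu>)
      then show ?thesis
        by (rule LIMSEQ_le_const2) (auto intro!: cSUP_upper AG bdd_above_wasserstein[OF diam \<mu> \<nu> G])
    qed
    moreover have "1-lipschitz_on UNIV (\<lambda>_::'s. 0::real)" by (simp add: lipschitz_on_def)
    ultimately have "wasserstein \<mu> \<nu> \<le> (SUP f\<in>G. ?d f)"
      unfolding wasserstein_eq by (intro cSUP_least) auto
    moreover have "(SUP f\<in>G. ?d f) \<le> wasserstein \<mu> \<nu>"
      unfolding wasserstein_eq
      by (intro cSUP_subset_mono Gne bdd_above_wasserstein[OF diam \<mu> \<nu>] G) auto
    ultimately show "wasserstein \<mu> \<nu> = (SUP f\<in>G. ?d f)" by simp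
  qed
qed

text \<open>After the reduction to a countable class this is a countable supremum of integrals, each
  a measurable function of the kernel. It makes the Wasserstein integrands integrable, so that their
  integrals can be compared.\<close>

lemma measurable_wasserstein:
  fixes K :: "'a \<Rightarrow> 's::polish_space measure"
  assumes diam: "\<And>x y :: 's. dist x y \<le> 1"
    and K[measurable]: "K \<in> N \<rightarrow>\<^sub>M prob_algebra borel" and \<nu>: "\<nu> \<in> space (prob_algebra borel)"
  shows "(\<lambda>x. wasserstein (K x) \<nu>) \<in> borel_measurable N"
proof -
  obtain G :: "('s \<Rightarrow> real) set" where G: "countable G" "G \<subseteq> {f. 1-lipschitz_on UNIV f}"
    "\<And>\<mu> \<nu>. \<mu> \<in> space (prob_algebra borel) \<Longrightarrow> \<nu> \<in> space (prob_algebra borel) \<Longrightarrow>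
      wasserstein \<mu> \<nu> = (SUP f\<in>G. \<bar>(\<integral>y. f y \<partial>\<mu>) - (\<integral>y. f y \<partial>\<nu>)\<bar>)"
    using wasserstein_countable[OF diam] by blast
  have Kx: "K x \<in> space (prob_algebra borel)" if "x \<in> space N" for x
    using measurable_space[OF K that] .
  have "(\<lambda>x. SUP f\<in>G. \<bar>(\<integral>y. f y \<partial>K x) - (\<integral>y. f y \<partial>\<nu>)\<bar>) \<in> borel_measurable N"
  proof (rule borel_measurable_cSUP[OF G(1)])
    fix f assume "f \<in> G"
    then have "f \<in> borel_measurable borel"
      using G(2) lipschitz_borel_measurable by blast
    then have "(\<lambda>x. \<integral>y. f y \<partial>K x) \<in> borel_measurable N"
      by (intro measurable_compose[OF measurable_prob_algebraD[OF K] integral_measurable_subprob_algebra])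
    then show "(\<lambda>x. \<bar>(\<integral>y. f y \<partial>K x) - (\<integral>y. f y \<partial>\<nu>)\<bar>) \<in> borel_measurable N"
      by measurable
  qed (rule bdd_above_wasserstein[OF diam Kx \<nu> G(2)])
  then show ?thesis
    by (rule measurable_cong[THEN iffD1, rotated]) (simp add: G(3) Kx \<nu>)
qed

section \<open>Second moments of integrals over time, and limits along sequences\<close>

text \<open>The square is a double integral over pairs of times, and Fubini brings the expectation
  inside. Pairs closer than \<open>r\<close> contribute at most \<open>C + E\<close>, all others at
  most \<open>C\<close>; each slice of the close pairs has mass at most \<open>m\<close>. The
  abstract \<open>\<nu>\<close> serves both kinds of time.\<close>

lemma (in finite_measure) expectation_square_integral_le:
  fixes g :: "real \<times> 'a \<Rightarrow> real"
  assumes \<nu>: "finite_measure \<nu>"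
    and g[measurable]: "g \<in> borel_measurable (\<nu> \<Otimes>\<^sub>M M)"
    and bound: "\<And>z. \<bar>g z\<bar> \<le> B"
    and corr: "\<And>u s. u \<in> space \<nu> \<Longrightarrow> s \<in> space \<nu> \<Longrightarrow>
      \<bar>\<integral>\<omega>. g (u, \<omega>) * g (s, \<omega>) \<partial>M\<bar> \<le> C + E * indicator {u - r<..<u + r} s"
    and meas: "\<And>u. {u - r<..<u + r} \<inter> space \<nu> \<in> sets \<nu>"
      "(\<lambda>x. x) \<in> borel_measurable \<nu>"
    and m: "\<And>u. u \<in> space \<nu> \<Longrightarrow> measure \<nu> ({u - r<..<u + r} \<inter> space \<nu>) \<le> m" and "E \<ge> 0"
  shows "(\<integral>\<omega>. (\<integral>s. g (s, \<omega>) \<partial>\<nu>)\<^sup>2 \<partial>M)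
    \<le> C * (measure \<nu> (space \<nu>))\<^sup>2 + E * m * measure \<nu> (space \<nu>)"
proof -
  interpret \<nu>: finite_measure \<nu> by fact
  interpret \<nu>2: pair_sigma_finite \<nu> \<nu> ..
  have fin2: "finite_measure (\<nu> \<Otimes>\<^sub>M \<nu>)"
    by (intro finite_measure_pair_measure \<nu>)
  interpret F2: finite_measure "\<nu> \<Otimes>\<^sub>M \<nu>" by (rule fin2)
  interpret P: pair_sigma_finite "\<nu> \<Otimes>\<^sub>M \<nu>" M ..
  have fin3: "finite_measure ((\<nu> \<Otimes>\<^sub>M \<nu>) \<Otimes>\<^sub>M M)"
    by (intro finite_measure_pair_measure fin2 finite_measure_axioms)
  have BB: "\<bar>g z * g z'\<bar> \<le> B * B" for z z'
    unfolding abs_mult by (intro mult_mono bound) (use bound[of z] in auto)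
  \<comment> \<open>Bounded integrands are integrable over the finite triple product, which licenses
    Fubini.\<close>
  have int3: "integrable ((\<nu> \<Otimes>\<^sub>M \<nu>) \<Otimes>\<^sub>M M) (\<lambda>(z, \<omega>). g (fst z, \<omega>) * g (snd z, \<omega>))"
    by (rule finite_measure.integrable_const_bound[OF fin3, where B="B * B"])
      (auto simp: BB)
  have int2: "integrable (\<nu> \<Otimes>\<^sub>M \<nu>) (\<lambda>z. g (fst z, \<omega>) * g (snd z, \<omega>))" if "\<omega> \<in> space M" for \<omega>
    using that by (intro F2.integrable_const_bound[where B="B * B"]) (auto simp: BB)
  have sq: "(\<integral>z. g (fst z, \<omega>) * g (snd z, \<omega>) \<partial>(\<nu> \<Otimes>\<^sub>M \<nu>)) = (\<integral>s. g (s, \<omega>) \<partial>\<nu>)\<^sup>2"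
    if "\<omega> \<in> space M" for \<omega>
    using \<nu>2.integral_fst'[OF int2[OF that]] by (simp add: power2_eq_square)
  \<comment> \<open>The band around the diagonal, measurable because both coordinates are Borel by
    \<open>meas(2)\<close>.\<close>
  define W where "W = {z \<in> space (\<nu> \<Otimes>\<^sub>M \<nu>). fst z - r < snd z \<and> snd z < fst z + r}"
  have W[measurable]: "W \<in> sets (\<nu> \<Otimes>\<^sub>M \<nu>)"
  proof -
    have [measurable]: "fst \<in> borel_measurable (\<nu> \<Otimes>\<^sub>M \<nu>)" "snd \<in> borel_measurable (\<nu> \<Otimes>\<^sub>M \<nu>)"
      by (auto intro: measurable_compose[OF measurable_fst meas(2)]
          measurable_compose[OF measurable_snd meas(2)])
    show ?thesis unfolding W_def by measurable
  qed
  have intW[simp]: "integrable (\<nu> \<Otimes>\<^sub>M \<nu>) (\<lambda>z. C + E * indicator W z)"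
    by (intro F2.integrable_const_bound[where B="\<bar>C\<bar> + \<bar>E\<bar>"]) (auto simp: indicator_def)
  have "(\<integral>\<omega>. (\<integral>s. g (s, \<omega>) \<partial>\<nu>)\<^sup>2 \<partial>M)
      = (\<integral>\<omega>. (\<integral>z. g (fst z, \<omega>) * g (snd z, \<omega>) \<partial>(\<nu> \<Otimes>\<^sub>M \<nu>)) \<partial>M)"
    by (intro Bochner_Integration.integral_cong) (simp_all add: sq)
  also have "\<dots> = (\<integral>z. (\<integral>\<omega>. g (fst z, \<omega>) * g (snd z, \<omega>) \<partial>M) \<partial>(\<nu> \<Otimes>\<^sub>M \<nu>))"
    by (rule P.Fubini_integral[OF int3])
  also have "\<dots> \<le> (\<integral>z. C + E * indicator W z \<partial>(\<nu> \<Otimes>\<^sub>M \<nu>))"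
  proof (rule integral_mono)
    show "integrable (\<nu> \<Otimes>\<^sub>M \<nu>) (\<lambda>z. \<integral>\<omega>. g (fst z, \<omega>) * g (snd z, \<omega>) \<partial>M)"
      using P.integrable_fst'[OF int3] by simp
    show "(\<integral>\<omega>. g (fst z, \<omega>) * g (snd z, \<omega>) \<partial>M) \<le> C + E * indicator W z"
      if "z \<in> space (\<nu> \<Otimes>\<^sub>M \<nu>)" for z
      using corr[of "fst z" "snd z"] that
      by (auto simp: space_pair_measure indicator_def W_def split: if_splits)
  qed simp
  also have "\<dots> = (\<integral>u. (\<integral>s. C + E * indicator W (u, s) \<partial>\<nu>) \<partial>\<nu>)"
    by (rule \<nu>2.integral_fst'[symmetric]) simp
  also have "\<dots> \<le> (\<integral>u. C * measure \<nu> (space \<nu>) + E * m \<partial>\<nu>)"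
  proof (rule integral_mono)
    show "integrable \<nu> (\<lambda>u. \<integral>s. C + E * indicator W (u, s) \<partial>\<nu>)"
      by (rule \<nu>2.integrable_fst') simp
    fix u assume u: "u \<in> space \<nu>"
    \<comment> \<open>Slicing the band at \<open>u\<close> leaves the window around
      \<open>u\<close>.\<close>
    have "(\<integral>s. C + E * indicator W (u, s) \<partial>\<nu>)
        = (\<integral>s. C + E * indicator ({u - r<..<u + r} \<inter> space \<nu>) s \<partial>\<nu>)"
      using u by (intro Bochner_Integration.integral_cong)
        (auto simp: W_def indicator_def space_pair_measure)
    also have "\<dots> = C * measure \<nu> (space \<nu>) + E * measure \<nu> ({u - r<..<u + r} \<inter> space \<nu>)"
      using meas(1)[of u] by (subst Bochner_Integration.integral_add)
        (auto intro!: integrable_mult_right integrable_real_indicator simp: \<nu>.emeasure_finite less_top[symmetric])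
    also have "\<dots> \<le> C * measure \<nu> (space \<nu>) + E * m"
      using m[OF u] \<open>E \<ge> 0\<close> by (intro add_left_mono mult_left_mono)
    finally show "(\<integral>s. C + E * indicator W (u, s) \<partial>\<nu>) \<le> C * measure \<nu> (space \<nu>) + E * m" .
  qed simp
  also have "\<dots> = C * (measure \<nu> (space \<nu>))\<^sup>2 + E * m * measure \<nu> (space \<nu>)"
    by (simp add: power2_eq_square algebra_simps)
  finally show ?thesis .
qed

text \<open>If the limit fails, some neighbourhood is missed at arbitrarily late times of
  \<open>I\<close>; picking such a time beyond each \<open>n\<close> gives a sequence violating the
  assumption. Dominated convergence, a statement on sequences, thereby becomes applicable.\<close>

lemma tendsto_at_top_within_sequentially:
  fixes f :: "real \<Rightarrow> 'b::first_countable_topology"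
  assumes *: "\<And>X. (\<And>n. X n \<in> I) \<Longrightarrow> filterlim X at_top sequentially \<Longrightarrow> (\<lambda>n. f (X n)) \<longlonglongrightarrow> y"
  shows "(f \<longlongrightarrow> y) (inf at_top (principal I))"
proof (rule topological_tendstoI, rule ccontr)
  fix S assume S: "open S" "y \<in> S" and "\<not> eventually (\<lambda>x. f x \<in> S) (inf at_top (principal I))"
  then have "\<forall>N. \<exists>x\<ge>N. x \<in> I \<and> f x \<notin> S"
    by (auto simp: eventually_inf_principal eventually_at_top_linorder)
  then have "\<forall>n::nat. \<exists>x. real n \<le> x \<and> x \<in> I \<and> f x \<notin> S"
    by blast
  then obtain X where X: "\<And>n::nat. real n \<le> X n" "\<And>n. X n \<in> I" "\<And>n. f (X n) \<notin> S"
    by metis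
  have "filterlim X at_top sequentially"
    using X(1) by (intro filterlim_at_top_mono[OF filterlim_real_sequentially] always_eventually) auto
  from topological_tendstoD[OF *[OF X(2) this] S] X(3) show False
    by auto
qed

section \<open>Markov property for bounded functions and correlations at two times\<close>

context markov_process
begin

lemma T_cases:
  obtains (discrete) "T = \<nat>" "\<tau> = count_space \<nat>"
    | (continuous) "T = {0..}" "\<tau> = restrict_space lborel {0..}"
  using time by (auto simp: time_set_def)

lemma add_in_T: "s \<in> T \<Longrightarrow> t \<in> T \<Longrightarrow> s + t \<in> T"
  by (cases rule: T_cases) auto

lemma P_in_prob_algebra: "P x \<in> space (prob_algebra A)"
  using measurable_space[OF kernel] by simp

lemma prob_space_P: "prob_space (P x)" and sets_P: "sets (P x) = sets A"
  using P_in_prob_algebra by (auto simp: space_prob_algebra)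

lemma measurable_M: "t \<in> T \<Longrightarrow> M t \<in> A \<rightarrow>\<^sub>M borel"
  using measurable_from_subalg[OF filtration_subalgebra adapted] .

lemma measurable_transition: "t \<in> T \<Longrightarrow> transition P M t \<in> borel \<rightarrow>\<^sub>M prob_algebra borel"
  unfolding transition_def
  by (rule measurable_compose[OF kernel measurable_distr_prob_space[OF measurable_M]])

lemma transition_in_prob_algebra: "t \<in> T \<Longrightarrow> transition P M t x \<in> space (prob_algebra borel)"
  using measurable_space[OF measurable_transition] by simp

lemma measurable_integral_transition:
  fixes \<phi> :: "'s \<Rightarrow> real"
  shows "t \<in> T \<Longrightarrow> \<phi> \<in> borel_measurable borel \<Longrightarrow>
    (\<lambda>y. \<integral>z. \<phi> z \<partial>transition P M t y) \<in> borel_measurable borel"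
  by (intro measurable_compose[OF measurable_prob_algebraD[OF measurable_transition]
        integral_measurable_subprob_algebra])

lemma abs_integral_transition_le:
  fixes \<phi> :: "'s \<Rightarrow> real"
  assumes "t \<in> T" "\<phi> \<in> borel_measurable borel" and bound: "\<And>z. \<bar>\<phi> z\<bar> \<le> K"
  shows "\<bar>\<integral>z. \<phi> z \<partial>transition P M t y\<bar> \<le> K"
proof -
  interpret prob_space "transition P M t y"
    using transition_in_prob_algebra[OF assms(1)] by (simp add: space_prob_algebra)
  have [measurable_cong]: "sets (transition P M t y) = sets borel"
    by (simp add: transition_def)
  note assms(2)[measurable]
  have [simp]: "integrable (transition P M t y) \<phi>"
    by (rule integrable_const_bound[where B=K]) (use bound in auto)
  have "\<bar>\<integral>z. \<phi> z \<partial>transition P M t y\<bar> \<le> (\<integral>z. \<bar>\<phi> z\<bar> \<partial>transition P M t y)"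
    using integral_norm_bound[of "transition P M t y" \<phi>] by simp
  also have "\<dots> \<le> K"
    using bound by (intro integral_le_const) auto
  finally show ?thesis .
qed

text \<open>Instead of approximating \<open>\<phi>\<close> by simple functions, the Markov property
  for sets is read as an equality of two measures on the state space, against which any bounded
  measurable \<open>\<phi>\<close> can be integrated.\<close>

lemma markov_function:
  fixes \<phi> :: "'s \<Rightarrow> real"
  assumes s: "s \<in> T" and t: "t \<in> T" and \<phi>[measurable]: "\<phi> \<in> borel_measurable borel"
    and bound: "\<And>z. \<bar>\<phi> z\<bar> \<le> K"
  shows "AE \<omega> in P x. real_cond_exp (P x) (F t) (\<lambda>\<omega>. \<phi> (M (t + s) \<omega>)) \<omega>
    = (\<integral>z. \<phi> z \<partial>transition P M s (M t \<omega>))"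
proof -
  interpret prob_space "P x" by (rule prob_space_P)
  note sets_P[measurable_cong]
  have sub: "subalgebra (P x) (F t)"
    using filtration_subalgebra[OF t] sets_P sets_eq_imp_space_eq[OF sets_P]
    by (simp add: subalgebra_def)
  interpret finite_measure_subalgebra "P x" "F t"
    by unfold_locales (rule sub)
  note adapted[OF t, measurable] measurable_M[OF t, measurable]
    measurable_M[OF add_in_T[OF t s], measurable]
    measurable_prob_algebraD[OF measurable_transition[OF s], measurable]
  note measurable_integral_transition[OF s \<phi>, measurable]
  have sp: "space (P x) = space A" by (rule sets_eq_imp_space_eq[OF sets_P])
  note bnd = abs_integral_transition_le[OF s \<phi> bound]
  show ?thesis
  proof (rule real_cond_exp_charact)
    fix S assume S: "S \<in> sets (F t)"
    then have SP[measurable]: "S \<in> sets (P x)" using sub by (auto simp: subalgebra_def)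
    \<comment> \<open>Restricting \<open>P x\<close> to \<open>S\<close> turns set integrals over
      \<open>S\<close> into plain integrals. The result is a subprobability, so it can be composed
      with the transition kernel.\<close>
    define N where "N = density (P x) (\<lambda>\<omega>. ennreal (indicator S \<omega>))"
    have [measurable_cong]: "sets N = sets (P x)" by (simp add: N_def)
    have N: "subprob_space N"
      by (rule subprob_spaceI) (auto simp: N_def emeasure_density not_empty ennreal_indicator measure_le_1)
    interpret N: subprob_space N by (rule N)
    have N_int: "(\<integral>\<omega>. f \<omega> \<partial>N) = (\<integral>\<omega>\<in>S. f \<omega> \<partial>P x)" if "f \<in> borel_measurable (P x)" for f :: "_ \<Rightarrow> real"
      using that unfolding N_def set_lebesgue_integral_def
      by (subst integral_density) auto
    have trKN: "(\<lambda>\<omega>. transition P M s (M t \<omega>)) \<in> N \<rightarrow>\<^sub>M subprob_algebra borel" by measurable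
    \<comment> \<open>The law of the process at time \<open>t + s\<close> on \<open>S\<close> is the
      mixture of the transition laws started from \<open>M t\<close>; on each Borel set this is
      \<open>markov\<close> integrated over \<open>S\<close>.\<close>
    have eq: "distr N borel (M (t + s)) = N \<bind> (\<lambda>\<omega>. transition P M s (M t \<omega>))"
    proof (rule measure_eqI)
      have ss: "sets (N \<bind> (\<lambda>\<omega>. transition P M s (M t \<omega>))) = sets borel"
        using N.subprob_not_empty by (intro sets_bind) (auto simp: transition_def)
      then show "sets (distr N borel (M (t + s))) = sets (N \<bind> (\<lambda>\<omega>. transition P M s (M t \<omega>)))"
        by simp
      fix B assume "B \<in> sets (distr N borel (M (t + s)))"
      then have B[measurable]: "B \<in> sets borel" by simp
      let ?I = "indicator {\<omega> \<in> space A. M (t + s) \<omega> \<in> B} :: _ \<Rightarrow> real"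
      have I[measurable]: "{\<omega> \<in> space A. M (t + s) \<omega> \<in> B} \<in> sets (P x)"
        unfolding sp[symmetric] by measurable
      have "measure (distr N borel (M (t + s))) B = (\<integral>\<omega>. ?I \<omega> \<partial>N)"
        by (subst measure_distr) (auto simp: N_def sp intro!: arg_cong2[where f=measure])
      also have "\<dots> = (\<integral>\<omega>\<in>S. ?I \<omega> \<partial>P x)" by (rule N_int) measurable
      also have "\<dots> = (\<integral>\<omega>\<in>S. real_cond_exp (P x) (F t) ?I \<omega> \<partial>P x)"
        by (rule real_cond_exp_intA[OF _ S])
          (use I in \<open>simp add: integrable_real_indicator less_top[symmetric]\<close>)
      also have "\<dots> = (\<integral>\<omega>\<in>S. measure (transition P M s (M t \<omega>)) B \<partial>P x)"
        using markov[OF s t B, of x] unfolding set_lebesgue_integral_def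
        by (intro integral_cong_AE) auto
      also have "\<dots> = (\<integral>\<omega>. measure (transition P M s (M t \<omega>)) B \<partial>N)"
        by (rule N_int[symmetric]) measurable
      also have "\<dots> = measure (N \<bind> (\<lambda>\<omega>. transition P M s (M t \<omega>))) B"
        by (rule N.measure_bind[OF trKN B, symmetric])
      finally show "emeasure (distr N borel (M (t + s))) B
          = emeasure (N \<bind> (\<lambda>\<omega>. transition P M s (M t \<omega>))) B"
        using subprob_space_bind[OF N trKN] N.finite_measure_distr[of "M (t + s)" borel]
        by (simp add: finite_measure.emeasure_eq_measure subprob_space.axioms(1))
    qed
    have "(\<integral>\<omega>\<in>S. \<phi> (M (t + s) \<omega>) \<partial>P x) = (\<integral>\<omega>. \<phi> (M (t + s) \<omega>) \<partial>N)"
      by (rule N_int[symmetric]) measurable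
    also have "\<dots> = (\<integral>z. \<phi> z \<partial>distr N borel (M (t + s)))"
      by (rule integral_distr[symmetric]) measurable
    also have "\<dots> = (\<integral>\<omega>. (\<integral>z. \<phi> z \<partial>transition P M s (M t \<omega>)) \<partial>N)"
      unfolding eq
    \<comment> \<open>\<open>K\<close> bounds the integrand and 1 the mass of the kernel.\<close>
    proof (rule integral_bind[OF \<phi> _ trKN, of K 1])
      show "AE \<omega> in N. emeasure (transition P M s (M t \<omega>)) (space (transition P M s (M t \<omega>))) \<le> ennreal 1"
        using prob_space.emeasure_space_1[OF transition_in_prob_algebra[OF s, unfolded space_prob_algebra, simplified, THEN conjunct2]]
        by simp
    qed (use bound N.finite_measure_axioms in auto)
    also have "\<dots> = (\<integral>\<omega>\<in>S. (\<integral>z. \<phi> z \<partial>transition P M s (M t \<omega>)) \<partial>P x)"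
      by (rule N_int) measurable
    finally show "(\<integral>\<omega>\<in>S. \<phi> (M (t + s) \<omega>) \<partial>P x)
        = (\<integral>\<omega>\<in>S. (\<integral>z. \<phi> z \<partial>transition P M s (M t \<omega>)) \<partial>P x)" .
  next
    show "integrable (P x) (\<lambda>\<omega>. \<phi> (M (t + s) \<omega>))"
      using bound by (intro integrable_const_bound[where B=K]) auto
    show "integrable (P x) (\<lambda>\<omega>. \<integral>z. \<phi> z \<partial>transition P M s (M t \<omega>))"
      using bnd by (intro integrable_const_bound[where B=K]) auto
    show "(\<lambda>\<omega>. \<integral>z. \<phi> z \<partial>transition P M s (M t \<omega>)) \<in> borel_measurable (F t)"
      by measurable
  qed
qed

text \<open>The factor at time \<open>t\<close> is \<open>F t\<close>-measurable and comes out of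
  the conditional expectation of the later one, which the Markov property evaluates; the remaining
  expectation depends on \<open>M t\<close> alone.\<close>

lemma correlation_eq:
  fixes \<phi> :: "'s \<Rightarrow> real"
  assumes s: "s \<in> T" and t: "t \<in> T" and \<phi>[measurable]: "\<phi> \<in> borel_measurable borel"
    and bound: "\<And>z. \<bar>\<phi> z\<bar> \<le> K"
  shows "(\<integral>\<omega>. \<phi> (M t \<omega>) * \<phi> (M (t + s) \<omega>) \<partial>P x)
    = (\<integral>y. \<phi> y * (\<integral>z. \<phi> z \<partial>transition P M s y) \<partial>transition P M t x)"
proof -
  interpret prob_space "P x" by (rule prob_space_P)
  note sets_P[measurable_cong]
  have sub: "subalgebra (P x) (F t)"
    using filtration_subalgebra[OF t] sets_P sets_eq_imp_space_eq[OF sets_P]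
    by (simp add: subalgebra_def)
  interpret finite_measure_subalgebra "P x" "F t"
    by unfold_locales (rule sub)
  note adapted[OF t, measurable] measurable_M[OF t, measurable]
    measurable_M[OF add_in_T[OF t s], measurable]
  note measurable_integral_transition[OF s \<phi>, measurable]
  have BB: "\<bar>\<phi> z * \<phi> z'\<bar> \<le> K * K" for z z'
    unfolding abs_mult by (intro mult_mono bound) (use bound[of z] in auto)
  have "(\<integral>\<omega>. \<phi> (M t \<omega>) * \<phi> (M (t + s) \<omega>) \<partial>P x)
      = (\<integral>\<omega>. \<phi> (M t \<omega>) * real_cond_exp (P x) (F t) (\<lambda>\<omega>. \<phi> (M (t + s) \<omega>)) \<omega> \<partial>P x)"
    by (rule real_cond_exp_intg(2)[symmetric])
      (auto intro!: integrable_const_bound[where B="K * K"] simp: BB)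
  also have "\<dots> = (\<integral>\<omega>. \<phi> (M t \<omega>) * (\<integral>z. \<phi> z \<partial>transition P M s (M t \<omega>)) \<partial>P x)"
    using markov_function[OF s t \<phi> bound, of x] by (intro integral_cong_AE) auto
  also have "\<dots> = (\<integral>y. \<phi> y * (\<integral>z. \<phi> z \<partial>transition P M s y) \<partial>transition P M t x)"
    unfolding transition_def[of P M t x] by (rule integral_distr[symmetric]) measurable
  finally show ?thesis .
qed

section \<open>The interval \<open>[0, t)\<close> in discrete and continuous time\<close>

lemma diff_in_T: "s \<in> T \<Longrightarrow> t \<in> T \<Longrightarrow> s \<le> t \<Longrightarrow> t - s \<in> T"
  by (cases rule: T_cases) auto

text \<open>As a measure of its own, the interval gives plain integrals over a finite measure, the
  form in which Fubini is applied.\<close>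

definition time_upto :: "real \<Rightarrow> real measure" where
  "time_upto t = restrict_space \<tau> {0..<t}"

lemma time_upto_continuous:
  assumes "T = {0..}" "\<tau> = restrict_space lborel {0..}"
  shows "time_upto t = restrict_space lborel {0..<t}"
  unfolding time_upto_def unfolding assms(2)
  by (subst restrict_restrict_space) (auto intro!: arg_cong2[where f=restrict_space])

lemma time_upto_discrete:
  assumes "\<tau> = count_space \<nat>"
  shows "time_upto (real n) = count_space (real ` {..<n})"
proof -
  have "{0..<real n} \<inter> \<nat> = real ` {..<n}" by (auto simp: Nats_def)
  then show ?thesis
    unfolding time_upto_def unfolding assms restrict_count_space by simp
qed

text \<open>Collects what the averaging argument needs of the interval, so that no later step
  distinguishes discrete from continuous time.\<close>

lemma time_upto_facts:
  assumes t: "t \<in> T" "0 < t"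
  shows finite_time_upto: "finite_measure (time_upto t)"
    and measure_time_upto: "measure (time_upto t) (space (time_upto t)) = t"
    and space_time_upto: "space (time_upto t) \<subseteq> T"
    and sets_time_upto: "\<And>a b. {a<..<b} \<inter> space (time_upto t) \<in> sets (time_upto t)"
    and borel_time_upto: "(\<lambda>x. x) \<in> borel_measurable (time_upto t)"
    and window_time_upto: "\<And>u. u \<in> space (time_upto t) \<Longrightarrow>
      measure (time_upto t) ({u - real k<..<u + real k} \<inter> space (time_upto t)) \<le> 2 * real k"
    and integral_time_upto: "\<And>g :: real \<Rightarrow> real. (LINT s:{0..<t}|\<tau>. g s) = (\<integral>s. g s \<partial>time_upto t)"
    and joint_time_upto: "(\<lambda>(s, \<omega>). M s \<omega>) \<in> time_upto t \<Otimes>\<^sub>M A \<rightarrow>\<^sub>M borel"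
proof -
  have "finite_measure (time_upto t) \<and> measure (time_upto t) (space (time_upto t)) = t \<and>
    space (time_upto t) \<subseteq> T \<and> (\<forall>a b. {a<..<b} \<inter> space (time_upto t) \<in> sets (time_upto t)) \<and>
    (\<lambda>x. x) \<in> borel_measurable (time_upto t) \<and>
    (\<forall>u\<in>space (time_upto t). measure (time_upto t) ({u - real k<..<u + real k} \<inter> space (time_upto t)) \<le> 2 * real k) \<and>
    {0..<t} \<inter> space \<tau> \<in> sets \<tau> \<and>
    (\<lambda>(s, \<omega>). M s \<omega>) \<in> time_upto t \<Otimes>\<^sub>M A \<rightarrow>\<^sub>M borel"
  proof (cases rule: T_cases)
    case discrete
    then obtain n where n: "t = real n" using t by (auto simp: Nats_def)
    note eq = time_upto_discrete[OF discrete(2), of n, folded n]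
    \<comment> \<open>Truncated subtraction is harmless: for \<open>i < k\<close> the interval
      starts at 0 and is only shorter. The count \<open>2 * k\<close> exceeds the open window by a
      little, matching the length in continuous time.\<close>
    have card: "card ({u - real k<..<u + real k} \<inter> real ` {..<n}) \<le> 2 * k" if u: "u \<in> real ` {..<n}" for u
    proof -
      obtain i where i: "u = real i" using u by blast
      have "{u - real k<..<u + real k} \<inter> real ` {..<n} \<subseteq> real ` {i - k..<i + k}"
        unfolding i by auto
      then have "card ({u - real k<..<u + real k} \<inter> real ` {..<n}) \<le> card (real ` {i - k..<i + k})"
        by (intro card_mono) auto
      also have "\<dots> \<le> card {i - k..<i + k}" by (rule card_image_le) simp
      also have "\<dots> \<le> 2 * k" by simp
      finally show ?thesis .
    qed
    have "measure (count_space (real ` {..<n})) ({u - real k<..<u + real k} \<inter> real ` {..<n}) \<le> 2 * real k"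
      if "u \<in> real ` {..<n}" for u
      using of_nat_mono[OF card[OF that], where ?'a = real]
      by (subst measure_count_space) auto
    \<comment> \<open>With countably many times, measurability of each \<open>M s\<close> already
      gives joint measurability.\<close>
    moreover have "(\<lambda>(s, \<omega>). M s \<omega>) \<in> count_space (real ` {..<n}) \<Otimes>\<^sub>M A \<rightarrow>\<^sub>M borel"
      using measurable_M discrete(1)
      by (intro measurable_pair_measure_countable1) (auto simp: countable_finite)
    moreover have "measure (count_space (real ` {..<n})) (real ` {..<n}) = real n"
      by (subst measure_count_space) (simp_all add: card_image inj_on_def)
    ultimately show ?thesis
      unfolding eq unfolding discrete by (auto simp: finite_measure_count_space n)
  next
    case continuous
    note eq = time_upto_continuous[OF continuous, of t]
    have em: "emeasure (time_upto t) S = emeasure lborel S" if "S \<subseteq> {0..<t}" for S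
      unfolding eq using that by (intro emeasure_restrict_space) auto
    have sp: "space (time_upto t) = {0..<t}" by (simp add: eq space_restrict_space)
    have fin: "finite_measure (time_upto t)"
      using t by (intro finite_measureI) (simp add: sp em)
    have meas: "measure (time_upto t) (space (time_upto t)) = t"
      using t by (simp add: sp em measure_def)
    have st: "{a<..<b} \<inter> space (time_upto t) \<in> sets (time_upto t)" for a b
      unfolding sp unfolding eq by (auto simp: sets_restrict_space)
    have idm: "(\<lambda>x. x) \<in> borel_measurable (time_upto t)"
      unfolding eq by (intro measurable_restrict_space1) simp
    have win: "measure (time_upto t) ({u - real k<..<u + real k} \<inter> space (time_upto t)) \<le> 2 * real k" for u
    proof -
      have "emeasure (time_upto t) ({u - real k<..<u + real k} \<inter> space (time_upto t))
          = emeasure lborel ({u - real k<..<u + real k} \<inter> space (time_upto t))"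
        by (intro em) (simp add: sp)
      also have "\<dots> \<le> emeasure lborel {u - real k<..<u + real k}"
        by (intro emeasure_mono) auto
      also have "\<dots> = ennreal (2 * real k)" by simp
      finally show ?thesis
        unfolding measure_def by (intro enn2real_leI) auto
    qed
    \<comment> \<open>Progressive measurability concerns \<open>[0, t]\<close> and
      \<open>F t\<close>. The identity maps \<open>[0, t)\<close> into \<open>[0, t]\<close>, and
      \<open>A\<close> is finer than \<open>F t\<close>, so composition yields joint measurability
      here.\<close>
    have sub: "subalgebra A (F t)" using filtration_subalgebra t by blast
    have [measurable]: "(\<lambda>\<omega>. \<omega>) \<in> A \<rightarrow>\<^sub>M F t"
      by (rule measurable_from_subalg[OF sub]) simp
    have "(\<lambda>x. x) \<in> time_upto t \<rightarrow>\<^sub>M restrict_space borel {0..t}"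
      using idm by (intro measurable_restrict_space2) (auto simp: sp)
    note this[measurable]
    have "(\<lambda>(s, \<omega>). M s \<omega>) \<in> restrict_space borel {0..t} \<Otimes>\<^sub>M F t \<rightarrow>\<^sub>M borel"
      using progressive continuous t by simp
    moreover have "(\<lambda>(s, \<omega>). (s, \<omega>)) \<in> time_upto t \<Otimes>\<^sub>M A \<rightarrow>\<^sub>M restrict_space borel {0..t} \<Otimes>\<^sub>M F t"
      by measurable
    ultimately have "(\<lambda>(s, \<omega>). M s \<omega>) \<in> time_upto t \<Otimes>\<^sub>M A \<rightarrow>\<^sub>M borel"
      using measurable_comp by fastforce
    then show ?thesis
      using fin meas st idm win unfolding sp unfolding continuous
      by (auto simp: sets_restrict_space space_restrict_space)
  qed
  then show "finite_measure (time_upto t)"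
    "measure (time_upto t) (space (time_upto t)) = t"
    "space (time_upto t) \<subseteq> T"
    "\<And>a b. {a<..<b} \<inter> space (time_upto t) \<in> sets (time_upto t)"
    "(\<lambda>x. x) \<in> borel_measurable (time_upto t)"
    "\<And>u. u \<in> space (time_upto t) \<Longrightarrow>
      measure (time_upto t) ({u - real k<..<u + real k} \<inter> space (time_upto t)) \<le> 2 * real k"
    "\<And>g :: real \<Rightarrow> real. (LINT s:{0..<t}|\<tau>. g s) = (\<integral>s. g s \<partial>time_upto t)"
    "(\<lambda>(s, \<omega>). M s \<omega>) \<in> time_upto t \<Otimes>\<^sub>M A \<rightarrow>\<^sub>M borel"
    by (auto simp: time_upto_def integral_restrict_space set_lebesgue_integral_def)
qed

section \<open>Measurability and boundedness of time averages\<close>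

definition avg :: "('s \<Rightarrow> real) \<Rightarrow> real \<Rightarrow> 'w \<Rightarrow> real" where
  "avg f t \<omega> = (1 / t) * (LINT s:{0..<t}|\<tau>. f (M s \<omega>))"

lemma measurable_avg:
  assumes t: "t \<in> T" "0 < t" and f[measurable]: "f \<in> borel_measurable borel"
  shows "avg f t \<in> borel_measurable A"
proof -
  interpret finite_measure "time_upto t" by (rule finite_time_upto[OF t])
  note joint_time_upto[OF t, measurable]
  \<comment> \<open>Coordinates are swapped so that the outcome is the parameter and time the
    variable integrated out.\<close>
  have "(\<lambda>(\<omega>, s). f (M s \<omega>)) = f \<circ> (\<lambda>(s, \<omega>). M s \<omega>) \<circ> (\<lambda>(\<omega>, s). (s, \<omega>))"
    by (auto simp: fun_eq_iff)
  also have "\<dots> \<in> borel_measurable (A \<Otimes>\<^sub>M time_upto t)"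
    by (intro measurable_comp[OF measurable_pair_swap'] measurable_comp[OF joint_time_upto[OF t]] f)
  finally have "(\<lambda>\<omega>. \<integral>s. f (M s \<omega>) \<partial>time_upto t) \<in> borel_measurable A"
    by (intro borel_measurable_lebesgue_integral)
  then show ?thesis
    unfolding avg_def[abs_def] integral_time_upto[OF t] by simp
qed

text \<open>The half-open interval has mass exactly \<open>t\<close> in both kinds of time, so a
  constant equals its own average and can be subtracted under the integral.\<close>

lemma
  assumes t: "t \<in> T" "0 < t" and f[measurable]: "f \<in> borel_measurable borel"
    and bound: "\<And>z. \<bar>f z - c\<bar> \<le> L" and \<omega>: "\<omega> \<in> space A"
  shows avg_minus: "avg f t \<omega> - c = (1 / t) * (\<integral>s. f (M s \<omega>) - c \<partial>time_upto t)"
    and abs_avg_minus_le: "\<bar>avg f t \<omega> - c\<bar> \<le> L"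
proof -
  interpret finite_measure "time_upto t" by (rule finite_time_upto[OF t])
  have [measurable]: "(\<lambda>s. M s \<omega>) \<in> time_upto t \<rightarrow>\<^sub>M borel"
    using measurable_compose[OF measurable_Pair2'[OF \<omega>] joint_time_upto[OF t]] by simp
  have int: "integrable (time_upto t) (\<lambda>s. f (M s \<omega>) - c)"
    using bound by (intro integrable_const_bound[where B=L]) auto
  have "(\<integral>s. f (M s \<omega>) \<partial>time_upto t) = (\<integral>s. (f (M s \<omega>) - c) + c \<partial>time_upto t)"
    by simp
  also have "\<dots> = (\<integral>s. f (M s \<omega>) - c \<partial>time_upto t) + c * t"
    by (subst Bochner_Integration.integral_add[OF int]) (simp_all add: measure_time_upto[OF t])
  finally show eq: "avg f t \<omega> - c = (1 / t) * (\<integral>s. f (M s \<omega>) - c \<partial>time_upto t)"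
    unfolding avg_def integral_time_upto[OF t] using t by (simp add: field_simps)
  have "\<bar>\<integral>s. f (M s \<omega>) - c \<partial>time_upto t\<bar> \<le> (\<integral>s. \<bar>f (M s \<omega>) - c\<bar> \<partial>time_upto t)"
    using integral_norm_bound[of "time_upto t" "\<lambda>s. f (M s \<omega>) - c"] by simp
  also have "\<dots> \<le> (\<integral>s. L \<partial>time_upto t)"
    using int bound by (intro integral_mono) auto
  also have "\<dots> = L * t" by (simp add: measure_time_upto[OF t])
  finally show "\<bar>avg f t \<omega> - c\<bar> \<le> L"
    unfolding eq using t by (simp add: abs_mult field_simps)
qed

section \<open>Second moment of the centred average from a fixed starting point\<close>

text \<open>Pairs of times at distance at least \<open>k\<close> have correlation at most
  \<open>L\<^sup>2 * \<epsilon>\<close>. Closer pairs cost at most an additional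
  \<open>L\<^sup>2\<close> and fill mass at most \<open>2 * k * t\<close>. Dividing by
  \<open>t\<^sup>2\<close> leaves the two terms of the bound.\<close>

lemma second_moment_le:
  fixes f :: "'s \<Rightarrow> real"
  assumes diam: "\<And>x y :: 's. dist x y \<le> 1" and \<pi>: "\<pi> \<in> space (prob_algebra borel)"
    and f: "L-lipschitz_on UNIV f" and "0 < L" "0 \<le> \<epsilon>"
    and small: "\<And>r s. r \<in> T \<Longrightarrow> s \<in> T \<Longrightarrow> real k \<le> r \<Longrightarrow>
      (\<integral>y. wasserstein (transition P M r y) \<pi> \<partial>transition P M s x) \<le> \<epsilon>"
    and t: "t \<in> T" "0 < t"
  shows "(\<integral>\<omega>. (avg f t \<omega> - (\<integral>y. f y \<partial>\<pi>))\<^sup>2 \<partial>P x) \<le> L\<^sup>2 * \<epsilon> + 2 * L\<^sup>2 * real k / t"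
proof -
  interpret prob_space "P x" by (rule prob_space_P)
  note sets_P[measurable_cong]
  have sp: "space (P x) = space A" by (rule sets_eq_imp_space_eq[OF sets_P])
  define h where "h = (\<lambda>y. f y - (\<integral>y. f y \<partial>\<pi>))"
  note fm[measurable] = lipschitz_borel_measurable[OF f]
  have hm[measurable]: "h \<in> borel_measurable borel" unfolding h_def by measurable
  have hb: "\<bar>h y\<bar> \<le> L" for y
    unfolding h_def by (rule lipschitz_minus_integral_bound[OF diam f \<pi>])
  \<comment> \<open>Centring turns the integral of \<open>h\<close> into the difference of the means
    of \<open>f\<close> under the transition law and \<open>\<pi>\<close>.\<close>
  have hW: "\<bar>\<integral>z. h z \<partial>transition P M r y\<bar> \<le> L * wasserstein (transition P M r y) \<pi>" if "r \<in> T" for r y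
  proof -
    note tr = transition_in_prob_algebra[OF that, of y]
    interpret tr: prob_space "transition P M r y" using tr by (simp add: space_prob_algebra)
    show ?thesis
      using integral_diff_le_wasserstein[OF diam f \<open>0 < L\<close> tr \<pi>]
      by (simp add: h_def integrable_lipschitz[OF diam f tr] tr.prob_space)
  qed
  have corr: "\<bar>\<integral>\<omega>. h (M u \<omega>) * h (M s \<omega>) \<partial>P x\<bar> \<le> L\<^sup>2 * \<epsilon> + L\<^sup>2 * indicator {u - real k<..<u + real k} s"
    if us: "u \<in> T" "s \<in> T" "u \<le> s" for u s
  proof -
    define r where "r = s - u"
    have r: "r \<in> T" "u + r = s" using us diff_in_T by (auto simp: r_def)
    interpret tr: prob_space "transition P M u x"
      using transition_in_prob_algebra[OF us(1), of x] by (simp add: space_prob_algebra)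
    have [measurable_cong]: "sets (transition P M u x) = sets borel" by (simp add: transition_def)
    note measurable_integral_transition[OF r(1) hm, measurable]
    note measurable_wasserstein[OF diam measurable_transition[OF r(1)] \<pi>, measurable]
    note Wb = wasserstein_bounds[OF diam transition_in_prob_algebra[OF r(1)] \<pi>]
    let ?H = "\<lambda>y. h y * (\<integral>z. h z \<partial>transition P M r y)"
    let ?W = "\<lambda>y. wasserstein (transition P M r y) \<pi>"
    \<comment> \<open>Two bounds on one integrand: the crude \<open>b1\<close> for close times,
      \<open>b2\<close> for distant ones, where the smallness hypothesis applies.\<close>
    have b1: "\<bar>?H y\<bar> \<le> L\<^sup>2" for y
      unfolding power2_eq_square abs_mult
      using \<open>0 < L\<close> by (intro mult_mono hb abs_integral_transition_le[OF r(1) hm hb]) auto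
    have b2: "\<bar>?H y\<bar> \<le> L\<^sup>2 * ?W y" for y
    proof -
      have "\<bar>?H y\<bar> \<le> L * (L * ?W y)"
        unfolding abs_mult using \<open>0 < L\<close> by (intro mult_mono hb hW[OF r(1)]) auto
      then show ?thesis by (simp add: power2_eq_square mult.assoc)
    qed
    have [simp]: "integrable (transition P M u x) (\<lambda>y. \<bar>?H y\<bar>)"
      using b1 by (intro tr.integrable_const_bound[where B="L\<^sup>2"]) auto
    have [simp]: "integrable (transition P M u x) ?W"
      using Wb by (intro tr.integrable_const_bound[where B=2]) auto
    have eq: "(\<integral>\<omega>. h (M u \<omega>) * h (M s \<omega>) \<partial>P x) = (\<integral>y. ?H y \<partial>transition P M u x)"
      using correlation_eq[OF r(1) us(1) hm hb] by (simp add: r(2))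
    have le: "\<bar>\<integral>y. ?H y \<partial>transition P M u x\<bar> \<le> (\<integral>y. \<bar>?H y\<bar> \<partial>transition P M u x)"
      using integral_norm_bound[of "transition P M u x" ?H] by simp
    show ?thesis
    proof (cases "real k \<le> r")
      case True
      have "(\<integral>y. \<bar>?H y\<bar> \<partial>transition P M u x) \<le> (\<integral>y. L\<^sup>2 * ?W y \<partial>transition P M u x)"
        using b2 by (intro integral_mono) auto
      also have "\<dots> \<le> L\<^sup>2 * \<epsilon>"
        using small[OF r(1) us(1) True] by (simp add: mult_left_mono)
      finally have "\<bar>\<integral>y. ?H y \<partial>transition P M u x\<bar> \<le> L\<^sup>2 * \<epsilon>"
        by (rule order_trans[OF le])
      then show ?thesis unfolding eq by (rule order_trans) simp
    next
      case False
      then have s: "s \<in> {u - real k<..<u + real k}" using us by (auto simp: r_def)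
      moreover have "(\<integral>y. \<bar>?H y\<bar> \<partial>transition P M u x) \<le> L\<^sup>2"
        using b1 by (intro tr.integral_le_const) auto
      moreover have "0 \<le> L\<^sup>2 * \<epsilon>" using \<open>0 \<le> \<epsilon>\<close> by simp
      ultimately have "\<bar>\<integral>y. ?H y \<partial>transition P M u x\<bar> \<le> L\<^sup>2 * \<epsilon> + L\<^sup>2"
        using le by linarith
      then show ?thesis unfolding eq using s by simp
    qed
  qed
  have corr': "\<bar>\<integral>\<omega>. h (M u \<omega>) * h (M s \<omega>) \<partial>P x\<bar> \<le> L\<^sup>2 * \<epsilon> + L\<^sup>2 * indicator {u - real k<..<u + real k} s"
    if us: "u \<in> T" "s \<in> T" for u s
  proof (cases "u \<le> s")
    case False
    then have "\<bar>\<integral>\<omega>. h (M s \<omega>) * h (M u \<omega>) \<partial>P x\<bar> \<le> L\<^sup>2 * \<epsilon> + L\<^sup>2 * indicator {s - real k<..<s + real k} u"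
      using corr us by simp
    also have "indicator {s - real k<..<s + real k} u = (indicator {u - real k<..<u + real k} s :: real)"
      by (auto simp: indicator_def)
    finally show ?thesis by (simp add: mult.commute)
  qed (use corr us in simp)
  have gm: "(\<lambda>(s, \<omega>). h (M s \<omega>)) \<in> borel_measurable (time_upto t \<Otimes>\<^sub>M P x)"
  proof -
    note joint_time_upto[OF t, measurable]
    have "(\<lambda>z. h ((\<lambda>(s, \<omega>). M s \<omega>) z)) \<in> borel_measurable (time_upto t \<Otimes>\<^sub>M P x)"
      by measurable
    then show ?thesis by (simp add: case_prod_beta')
  qed
  have "(\<integral>\<omega>. (avg f t \<omega> - (\<integral>y. f y \<partial>\<pi>))\<^sup>2 \<partial>P x)
      = (\<integral>\<omega>. (1 / t)\<^sup>2 * (\<integral>s. h (M s \<omega>) \<partial>time_upto t)\<^sup>2 \<partial>P x)"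
    using avg_minus[OF t fm hb[unfolded h_def]]
    by (intro Bochner_Integration.integral_cong) (auto simp: sp h_def power_divide)
  also have "\<dots> = (1 / t)\<^sup>2 * (\<integral>\<omega>. (\<integral>s. h (M s \<omega>) \<partial>time_upto t)\<^sup>2 \<partial>P x)"
    by simp
  also have "\<dots> \<le> (1 / t)\<^sup>2 * (L\<^sup>2 * \<epsilon> * t\<^sup>2 + L\<^sup>2 * (2 * real k) * t)"
  proof (rule mult_left_mono)
    show "(\<integral>\<omega>. (\<integral>s. h (M s \<omega>) \<partial>time_upto t)\<^sup>2 \<partial>P x) \<le> L\<^sup>2 * \<epsilon> * t\<^sup>2 + L\<^sup>2 * (2 * real k) * t"
      using expectation_square_integral_le[OF finite_time_upto[OF t] gm, of L "L\<^sup>2 * \<epsilon>" "L\<^sup>2" "real k" "2 * real k"]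
        hb corr' space_time_upto[OF t] sets_time_upto[OF t] borel_time_upto[OF t] window_time_upto[OF t]
      by (auto simp: measure_time_upto[OF t] subset_iff split_beta)
  qed simp
  also have "\<dots> = L\<^sup>2 * \<epsilon> + 2 * L\<^sup>2 * real k / t"
    using t by (simp add: field_simps power2_eq_square)
  finally show ?thesis .
qed

text \<open>First \<open>\<epsilon>\<close> makes one term of the bound equal to half the tolerance,
  then the ergodicity assumption at \<open>x\<close> supplies \<open>k\<close>, and late times make
  the other term small. As \<open>k\<close> depends on \<open>x\<close>, the convergence is only
  pointwise in the starting point.\<close>

lemma second_moment_tendsto:
  fixes f :: "'s \<Rightarrow> real"
  assumes diam: "\<And>x y :: 's. dist x y \<le> 1" and \<pi>: "\<pi> \<in> space (prob_algebra borel)"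
    and f: "L-lipschitz_on UNIV f" and "0 < L"
    and lim: "((\<lambda>t. SUP s\<in>T. \<integral>y. wasserstein (transition P M t y) \<pi> \<partial>(transition P M s x))
            \<longlongrightarrow> 0) (inf at_top (principal T))"
    and X: "\<And>n::nat. X n \<in> T" "\<And>n. 0 < X n" "filterlim X at_top sequentially"
  shows "(\<lambda>n. \<integral>\<omega>. (avg f (X n) \<omega> - (\<integral>y. f y \<partial>\<pi>))\<^sup>2 \<partial>P x) \<longlonglongrightarrow> 0"
proof (rule tendstoI)
  fix e :: real assume e: "0 < e"
  define \<epsilon> where "\<epsilon> = e / (2 * L\<^sup>2)"
  have \<epsilon>: "0 < \<epsilon>" "L\<^sup>2 * \<epsilon> = e / 2" using e \<open>0 < L\<close> by (auto simp: \<epsilon>_def)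
  let ?I = "\<lambda>r s. \<integral>y. wasserstein (transition P M r y) \<pi> \<partial>transition P M s x"
  have "eventually (\<lambda>r. (SUP s\<in>T. ?I r s) < \<epsilon>) (inf at_top (principal T))"
    using order_tendstoD(2)[OF lim \<epsilon>(1)] .
  then obtain R where R: "\<And>r. r \<in> T \<Longrightarrow> R \<le> r \<Longrightarrow> (SUP s\<in>T. ?I r s) < \<epsilon>"
    by (auto simp: eventually_inf_principal eventually_at_top_linorder)
  \<comment> \<open>The threshold is rounded up because the window width is a natural
    number.\<close>
  define k where "k = nat \<lceil>R\<rceil>"
  have small: "?I r s \<le> \<epsilon>" if "r \<in> T" "s \<in> T" "real k \<le> r" for r s
  proof -
    note Wb = wasserstein_bounds[OF diam transition_in_prob_algebra[OF that(1)] \<pi>]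
    \<comment> \<open>This bound makes the supremum over \<open>s\<close> dominate each single
      value.\<close>
    have "?I r s' \<le> 2" if s': "s' \<in> T" for s'
    proof -
      interpret tr: prob_space "transition P M s' x"
        using transition_in_prob_algebra[OF s', of x] by (simp add: space_prob_algebra)
      have [measurable_cong]: "sets (transition P M s' x) = sets borel" by (simp add: transition_def)
      note measurable_wasserstein[OF diam measurable_transition[OF \<open>r \<in> T\<close>] \<pi>, measurable]
      show ?thesis
        using Wb by (intro tr.integral_le_const tr.integrable_const_bound[where B=2]) auto
    qed
    then have "?I r s \<le> (SUP s\<in>T. ?I r s)"
      using that by (intro cSUP_upper bdd_aboveI2[where M=2]) auto
    also have "\<dots> < \<epsilon>"
      using that real_nat_ceiling_ge[of R, folded k_def] by (intro R) auto
    finally show ?thesis by simp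
  qed
  have "((\<lambda>n. 2 * L\<^sup>2 * real k / X n) \<longlongrightarrow> 0) sequentially"
    by (intro real_tendsto_divide_at_top[OF tendsto_const] X)
  then have "eventually (\<lambda>n. 2 * L\<^sup>2 * real k / X n < e / 2) sequentially"
    using e by (intro order_tendstoD(2)) auto
  then show "eventually (\<lambda>n. dist (\<integral>\<omega>. (avg f (X n) \<omega> - (\<integral>y. f y \<partial>\<pi>))\<^sup>2 \<partial>P x) 0 < e) sequentially"
  proof eventually_elim
    case (elim n)
    have "0 \<le> (\<integral>\<omega>. (avg f (X n) \<omega> - (\<integral>y. f y \<partial>\<pi>))\<^sup>2 \<partial>P x)" by simp
    moreover have "(\<integral>\<omega>. (avg f (X n) \<omega> - (\<integral>y. f y \<partial>\<pi>))\<^sup>2 \<partial>P x) \<le> L\<^sup>2 * \<epsilon> + 2 * L\<^sup>2 * real k / X n"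
      by (rule second_moment_le[OF diam \<pi> f \<open>0 < L\<close> less_imp_le[OF \<epsilon>(1)] small X(1,2)])
    ultimately show ?case using elim \<epsilon> by simp
  qed
qed

end

section \<open>Control of moments of order \<open>p\<close> by second moments\<close>

text \<open>Boundedness trades all but one power of \<open>\<bar>Y\<bar>\<close> for a power of
  \<open>L\<close>, and the first absolute moment is at most the root of the second. This treats
  exponents below and above 2 alike.\<close>

lemma (in prob_space) expectation_powr_le:
  fixes Y :: "'a \<Rightarrow> real"
  assumes [measurable]: "Y \<in> borel_measurable M" and bound: "\<And>\<omega>. \<omega> \<in> space M \<Longrightarrow> \<bar>Y \<omega>\<bar> \<le> L"
    and p: "1 \<le> p"
  shows "expectation (\<lambda>\<omega>. \<bar>Y \<omega>\<bar> powr p) \<le> L powr (p - 1) * sqrt (expectation (\<lambda>\<omega>. (Y \<omega>)\<^sup>2))"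
    and "integrable M (\<lambda>\<omega>. \<bar>Y \<omega>\<bar> powr p)"
proof -
  show int: "integrable M (\<lambda>\<omega>. \<bar>Y \<omega>\<bar> powr p)"
    using bound p by (intro integrable_const_bound[where B="L powr p"]) (auto intro!: AE_I2 powr_mono2)
  have int1: "integrable M (\<lambda>\<omega>. \<bar>Y \<omega>\<bar>)"
    using bound by (intro integrable_const_bound[where B=L]) auto
  have int2: "integrable M (\<lambda>\<omega>. \<bar>Y \<omega>\<bar>\<^sup>2)"
    using bound power_mono[OF bound abs_ge_zero, of _ 2]
    by (intro integrable_const_bound[where B="L\<^sup>2"]) auto
  have "\<bar>Y \<omega>\<bar> powr p \<le> L powr (p - 1) * \<bar>Y \<omega>\<bar>" if "\<omega> \<in> space M" for \<omega>
  proof (cases "Y \<omega> = 0")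
    case False
    then have "\<bar>Y \<omega>\<bar> powr p = \<bar>Y \<omega>\<bar> powr (p - 1) * \<bar>Y \<omega>\<bar>"
      using powr_add[of "\<bar>Y \<omega>\<bar>" "p - 1" 1] by simp
    also have "\<dots> \<le> L powr (p - 1) * \<bar>Y \<omega>\<bar>"
      using bound[OF that] p by (intro mult_right_mono powr_mono2) auto
    finally show ?thesis .
  qed simp
  then have "expectation (\<lambda>\<omega>. \<bar>Y \<omega>\<bar> powr p) \<le> expectation (\<lambda>\<omega>. L powr (p - 1) * \<bar>Y \<omega>\<bar>)"
    using int int1 by (intro integral_mono) auto
  also have "\<dots> = L powr (p - 1) * expectation (\<lambda>\<omega>. \<bar>Y \<omega>\<bar>)" by simp
  also have "\<dots> \<le> L powr (p - 1) * sqrt (expectation (\<lambda>\<omega>. (Y \<omega>)\<^sup>2))"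
  proof (intro mult_left_mono real_le_rsqrt)
    \<comment> \<open>Cauchy-Schwarz in the form of a nonnegative variance.\<close>
    have "0 \<le> variance (\<lambda>\<omega>. \<bar>Y \<omega>\<bar>)" by (rule variance_positive)
    then show "(expectation (\<lambda>\<omega>. \<bar>Y \<omega>\<bar>))\<^sup>2 \<le> expectation (\<lambda>\<omega>. (Y \<omega>)\<^sup>2)"
      unfolding variance_eq[OF int1 int2] by simp
  qed simp
  finally show "expectation (\<lambda>\<omega>. \<bar>Y \<omega>\<bar> powr p) \<le> L powr (p - 1) * sqrt (expectation (\<lambda>\<omega>. (Y \<omega>)\<^sup>2))" .
qed

section \<open>Convergence in \<open>L\<^sup>p\<close> from an arbitrary initial law\<close>

theorem theorem1p2:
  fixes T :: "real set" and \<tau> :: "real measure"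
    and A :: "'w measure" and P :: "'s::polish_space \<Rightarrow> 'w measure"
    and F :: "real \<Rightarrow> 'w measure" and \<theta> :: "real \<Rightarrow> 'w \<Rightarrow> 'w"
    and M :: "real \<Rightarrow> 'w \<Rightarrow> 's" and \<pi> :: "'s measure"
  assumes "\<And>x y :: 's. dist x y \<le> 1"
    and "markov_process T \<tau> A P F \<theta> M"
    and "\<pi> \<in> space (prob_algebra borel)"
    and "\<And>x. ((\<lambda>t. SUP s\<in>T. \<integral>y. wasserstein (transition P M t y) \<pi> \<partial>(transition P M s x))
            \<longlongrightarrow> 0) (inf at_top (principal T))"
  shows "\<forall>p \<ge> 1. \<forall>f \<in> Lip. \<forall>\<mu> \<in> space (prob_algebra borel).
    converges_in_Lp p (\<mu> \<bind> P) {t \<in> T. 0 < t}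
      (\<lambda>t \<omega>. (1 / t) * (LINT s:{0..<t}|\<tau>. f (M s \<omega>)))
      (\<lambda>\<omega>. \<integral>y. f y \<partial>\<pi>)"
proof (intro allI impI ballI)
  fix p :: real and f :: "'s \<Rightarrow> real" and \<mu> :: "'s measure"
  assume p: "1 \<le> p" and "f \<in> Lip" and \<mu>: "\<mu> \<in> space (prob_algebra borel)"
  note diam = assms(1) and \<pi> = assms(3) and lim = assms(4)
  interpret markov_process T \<tau> A P F \<theta> M by fact
  obtain L0 where "L0-lipschitz_on UNIV f" using \<open>f \<in> Lip\<close> by (auto simp: Lip_def)
  \<comment> \<open>Enlarging the constant makes it strictly positive even for constant
    \<open>f\<close>, as the division by \<open>L\<close> requires.\<close>
  then have f: "(\<bar>L0\<bar> + 1)-lipschitz_on UNIV f" by (rule lipschitz_on_le) simp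
  define L where "L = \<bar>L0\<bar> + 1"
  note f = f[folded L_def]
  have L: "0 < L" by (simp add: L_def)
  note fm = lipschitz_borel_measurable[OF f]
  define c where "c = (\<integral>y. f y \<partial>\<pi>)"
  have fb: "\<bar>f z - c\<bar> \<le> L" for z
    unfolding c_def by (rule lipschitz_minus_integral_bound[OF diam f \<pi>])
  define N where "N = \<mu> \<bind> P"
  have PN[measurable]: "P \<in> \<mu> \<rightarrow>\<^sub>M prob_algebra A"
    using kernel \<mu> by (simp add: space_prob_algebra cong: measurable_cong_sets)
  have setsN[measurable_cong]: "sets N = sets A"
    unfolding N_def by (rule sets_bind'[OF \<mu> kernel])
  have spN: "space N = space A" by (rule sets_eq_imp_space_eq[OF setsN])
  interpret N: prob_space N
    unfolding N_def by (rule prob_space_bind'[OF \<mu> kernel])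
  interpret \<mu>: prob_space \<mu> using \<mu> by (simp add: space_prob_algebra)
  have Ym: "avg f t \<in> borel_measurable A" if "t \<in> T" "0 < t" for t
    by (rule measurable_avg[OF that fm])
  have Yb: "\<bar>avg f t \<omega> - c\<bar> \<le> L" if "t \<in> T" "0 < t" "\<omega> \<in> space A" for t \<omega>
    by (rule abs_avg_minus_le[OF that(1,2) fm fb that(3)])
  have avgLp: "avg f t \<in> Lp_space p N" if t: "t \<in> T" "0 < t" for t
  proof -
    note Ym[OF t, measurable]
    have "\<bar>avg f t \<omega>\<bar> \<le> L + \<bar>c\<bar>" if "\<omega> \<in> space N" for \<omega>
      using Yb[OF t, of \<omega>] that by (simp add: spN)
    from N.expectation_powr_le(2)[OF _ this p] show ?thesis
      by (simp add: Lp_space_def)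
  qed
  have "((\<lambda>t. Lp_norm p N (\<lambda>\<omega>. avg f t \<omega> - c)) \<longlongrightarrow> 0) (inf at_top (principal {t \<in> T. 0 < t}))"
  proof (rule tendsto_at_top_within_sequentially)
    fix X :: "nat \<Rightarrow> real" assume "\<And>n. X n \<in> {t \<in> T. 0 < t}" and X3: "filterlim X at_top sequentially"
    then have X: "\<And>n. X n \<in> T" "\<And>n. 0 < X n" by auto
    note Ym[OF X, measurable]
    have sqb: "(avg f (X n) \<omega> - c)\<^sup>2 \<le> L\<^sup>2" if "\<omega> \<in> space A" for n \<omega>
      using Yb[OF X that, of n] L by (simp add: abs_le_square_iff[symmetric])
    \<comment> \<open>The second moment vanishes for each starting point \<open>x\<close>, and
      \<open>L\<^sup>2\<close> dominates it uniformly, so the limit passes through the integral over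
      \<open>\<mu>\<close>.\<close>
    have "(\<lambda>n. \<integral>x. (\<integral>\<omega>. (avg f (X n) \<omega> - c)\<^sup>2 \<partial>P x) \<partial>\<mu>) \<longlonglongrightarrow> (\<integral>x. 0 \<partial>\<mu>)"
    proof (rule integral_dominated_convergence[where w="\<lambda>_. L\<^sup>2"])
      show "(\<lambda>x. \<integral>\<omega>. (avg f (X n) \<omega> - c)\<^sup>2 \<partial>P x) \<in> borel_measurable \<mu>" for n
        by (rule measurable_compose[OF measurable_prob_algebraD[OF PN] integral_measurable_subprob_algebra])
          measurable
      show "AE x in \<mu>. (\<lambda>n. \<integral>\<omega>. (avg f (X n) \<omega> - c)\<^sup>2 \<partial>P x) \<longlonglongrightarrow> 0"
        using second_moment_tendsto[OF diam \<pi> f L lim X X3] by (simp add: c_def)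
      show "AE x in \<mu>. norm (\<integral>\<omega>. (avg f (X n) \<omega> - c)\<^sup>2 \<partial>P x) \<le> L\<^sup>2" for n
      proof (rule AE_I2)
        fix x
        interpret prob_space "P x" by (rule prob_space_P)
        note sets_P[measurable_cong]
        have sp: "space (P x) = space A" by (rule sets_eq_imp_space_eq[OF sets_P])
        have "(\<integral>\<omega>. (avg f (X n) \<omega> - c)\<^sup>2 \<partial>P x) \<le> L\<^sup>2"
          using sqb by (intro integral_le_const integrable_const_bound[where B="L\<^sup>2"] AE_I2)
            (auto simp: sp)
        then show "norm (\<integral>\<omega>. (avg f (X n) \<omega> - c)\<^sup>2 \<partial>P x) \<le> L\<^sup>2" by simp
      qed
    qed simp_all
    \<comment> \<open>Expectation under the mixture \<open>N\<close> is the
      \<open>\<mu>\<close>-average of the expectations under \<open>P x\<close>.\<close>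
    moreover have "(\<integral>\<omega>. (avg f (X n) \<omega> - c)\<^sup>2 \<partial>N) = (\<integral>x. (\<integral>\<omega>. (avg f (X n) \<omega> - c)\<^sup>2 \<partial>P x) \<partial>\<mu>)" for n
      unfolding N_def
    proof (rule integral_bind[OF _ _ measurable_prob_algebraD[OF PN], of _ "L\<^sup>2" 1])
      show "AE x in \<mu>. emeasure (P x) (space (P x)) \<le> ennreal 1"
        by (simp add: prob_space.emeasure_space_1[OF prob_space_P])
    qed (use sqb \<mu>.finite_measure_axioms in auto)
    ultimately have E2: "(\<lambda>n. \<integral>\<omega>. (avg f (X n) \<omega> - c)\<^sup>2 \<partial>N) \<longlonglongrightarrow> 0" by simp
    have "(\<lambda>n. L powr (p - 1) * sqrt (\<integral>\<omega>. (avg f (X n) \<omega> - c)\<^sup>2 \<partial>N)) \<longlonglongrightarrow> L powr (p - 1) * sqrt 0"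
      by (intro tendsto_intros E2)
    then have upper: "(\<lambda>n. L powr (p - 1) * sqrt (\<integral>\<omega>. (avg f (X n) \<omega> - c)\<^sup>2 \<partial>N)) \<longlonglongrightarrow> 0"
      by simp
    have le: "(\<integral>\<omega>. \<bar>avg f (X n) \<omega> - c\<bar> powr p \<partial>N)
        \<le> L powr (p - 1) * sqrt (\<integral>\<omega>. (avg f (X n) \<omega> - c)\<^sup>2 \<partial>N)" for n
      by (rule N.expectation_powr_le(1)[OF _ Yb[OF X] p]) (simp_all add: spN)
    have "(\<lambda>n. \<integral>\<omega>. \<bar>avg f (X n) \<omega> - c\<bar> powr p \<partial>N) \<longlonglongrightarrow> 0"
    proof (rule tendsto_sandwich[OF _ _ tendsto_const upper])
      show "\<forall>\<^sub>F n in sequentially. 0 \<le> (\<integral>\<omega>. \<bar>avg f (X n) \<omega> - c\<bar> powr p \<partial>N)"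
        by (intro always_eventually allI integral_nonneg) simp
    qed (use le in \<open>intro always_eventually allI\<close>)
    \<comment> \<open>The root \<open>1 / p\<close> has a positive exponent, so it preserves
      convergence to 0.\<close>
    then show "(\<lambda>n. Lp_norm p N (\<lambda>\<omega>. avg f (X n) \<omega> - c)) \<longlonglongrightarrow> 0"
      unfolding Lp_norm_def using p
      by (intro tendsto_zero_powrI[OF _ tendsto_const]) auto
  qed
  moreover have "(\<lambda>\<omega>. c) \<in> Lp_space p N" by (simp add: Lp_space_def)
  ultimately show "converges_in_Lp p (\<mu> \<bind> P) {t \<in> T. 0 < t}
      (\<lambda>t \<omega>. (1 / t) * (LINT s:{0..<t}|\<tau>. f (M s \<omega>))) (\<lambda>\<omega>. \<integral>y. f y \<partial>\<pi>)"
    using avgLp unfolding converges_in_Lp_def N_def c_def avg_def[abs_def] by auto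
qed

end
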